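(* Let $d\ge 2$. The relation $\sim$ ("differ by a cluster boundary swap") is an equivalence relation on $\Omega^2$. Moreover, let $(f_1,f_2)\in\Omega^2$ and $g:=f_1-f_2$. Then the elements of the equivalence class of $(f_1,f_2)$ correspond naturally to the graph homomorphisms from the tree $\operatorname{LSD}(g)$ to $(d+1)\mathbb Z$ which map the $g$-level set containing $\mathbf 0$ to $g(\mathbf 0)$; that is, the map sending $(f_1',f_2')\sim(f_1,f_2)$ to the function $g':=f_1'-f_2'$, viewed as a function on the vertices of $\operatorname{LSD}(g')=\operatorname{LSD}(g)$, is a bijection from the equivalence class of $(f_1,f_2)$ onto the set of such graph homomorphisms.
   Context: Fix an integer $d\ge 2$. Let $\mathbf e_1,\dots,\mathbf e_{d+1}$ be the standard basis of $\mathbb R^{d+1}$, $\mathbf n=\mathbf e_1+\dots+\mathbf e_{d+1}$, $H=\mathbf n^\perp\subset\mathbb R^{d+1}$, $P$ the orthogonal projection onto $H$, and $\mathbf g_i=P\mathbf e_i=\mathbf e_i-\mathbf n/(d+1)$. The simplicial lattice $(X^d,E^d)$ is the graph with vertex set $X^d=P(\mathbb Z^{d+1})\subset H$ (equivalently $\mathbb Z^{d+1}/\mathbb Z\mathbf n$) and edges $\{\mathbf x,\mathbf x+\mathbf g_i\}$, $\mathbf x\in X^d$, $1\le i\le d+1$. A height function is a function $f:X^d\to\mathbb Z$ with $f(\mathbf 0)\in(d+1)\mathbb Z$ and $f(\mathbf x+\mathbf g_i)-f(\mathbf x)\in\{1,-d\}$ for all $\mathbf x\in X^d$ and $i$. $\Omega$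 is the set of height functions. For $f\in\Omega$, $T(f):=\{\{\mathbf x,\mathbf x+\mathbf g_i\}\in E^d: f(\mathbf x+\mathbf g_i)-f(\mathbf x)=-d\}$. A simplicial loop is a closed path $(\mathbf s_k)_{0\le k\le d+1}$ in $X^d$ with $\mathbf s_k=\mathbf s_{k-1}+\mathbf g_{\xi(k)}$ for some permutation $\xi$ of $\{1,\dots,d+1\}$. A tiling is a set $T\subset E^d$ containing exactly one edge of every simplicial loop; $\Theta$ is the set of tilings. The map $\Phi:\Omega\to(d+1)\mathbb Z\times\Theta$, $f\mapsto(f(\mathbf 0),T(f))$ is a bijection. $A\ominus B$ denotes symmetric difference. For $f_1,f_2\in\Omega$ and $g=f_1-f_2$ put $V_g:=T(f_1)\ominus T(f_2)=\{e\in E^d: g\text{ is not constant on }e\}$. The boundary graph $G_g$ has vertex set $V_g$, and two elements of $V_g$ are adjacent if some simplicial loop traverses both. A $g$-boundary is a connected component of $G_g$, considered as a subset of $V_g\subset E^d$. A $g$-level set is a connected component of the graph $(X^d,E^d\smallsetminus V_g)$, considered as a subset of $X^d$; $g$ is constant on each. For $e\in V_g$, $\mathbf x_g^-(e)$ and $\mathbf x_g^+(e)$ are the endpoints of $e$ at which $g$ takes the smaller, respectively larger, value; $\mathbf x_g^\pm(E)=\{\mathbf x_g^\pm(e):e\in E\}$. $\operatorname{LSD}(g)$ is the graph whose vertices are the $g$-level sets and whose edges are the $g$-boundaries, where a $g$-boundary $E$ connects the $g$-level set containing $\mathbf x_g^-(E)$ to the one containing $\mathbf x_g^+(E)$ (it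 is known that this is well-defined and a tree). If $M\subset V_g$ is a union of $g$-boundaries, then $T(f_i)\ominus M$ are tilings, and $(f_1,f_2)\ominus M:=(f_1',f_2')$ where $f_i'=\Phi^{-1}(f_i(\mathbf 0),T(f_i)\ominus M)$; in this case $\operatorname{LSD}(f_1'-f_2')=\operatorname{LSD}(g)$. Write $(f_1,f_2)\sim(f_1',f_2')$ if $(f_1',f_2')=(f_1,f_2)\ominus M$ for some union $M$ of $g$-boundaries. The set $(d+1)\mathbb Z$ is regarded as a graph in which $a,b$ are adjacent iff $|a-b|=d+1$. *)

theory Defs
  imports "HOL-Analysis.Analysis"
begin

text \<open>
  The coordinates of \<open>\<real>\<^bsup>d+1\<^esup>\<close> are indexed by a finite type \<open>'n\<close>; thus
  \<open>CARD('n) = d + 1\<close> throughout, and \<open>d = CARD('n) - 1\<close>.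
\<close>

section \<open>Graphs\<close>

text \<open>
  A simple graph is a vertex set together with a set of two-element sets of vertices.
\<close>

definition graph_components :: "'v set \<Rightarrow> 'v set set \<Rightarrow> 'v set set" where
  "graph_components V E =
     V // {(x, y). x \<in> V \<and> y \<in> V \<and> (x, y) \<in> {(u, v). {u, v} \<in> E}\<^sup>*}"

text \<open>
  Graphs whose edges are objects in their own right; \<open>ends G e\<close> is the set of endpoints of \<open>e\<close>.
\<close>

record ('v, 'e) mgraph =
  verts :: "'v set"
  edges :: "'e set"
  ends :: "'e \<Rightarrow> 'v set"

text \<open>
  Graph homomorphisms into a simple graph \<open>(V, E)\<close>. They are functions on \<open>verts G\<close> only, hence
  extensional.
\<close>

definition graph_homs :: "('v, 'e) mgraph \<Rightarrow> 'w set \<Rightarrow> 'w set set \<Rightarrow> ('v \<Rightarrow> 'w) set" where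
  "graph_homs G V E = {\<phi> \<in> verts G \<rightarrow>\<^sub>E V. \<forall>e \<in> edges G. \<phi> ` ends G e \<in> E}"

definition multiples :: "nat \<Rightarrow> int set" where
  "multiples m = {a. int m dvd a}"

definition multiples_edges :: "nat \<Rightarrow> int set set" where
  "multiples_edges m = {{a, b} | a b. a \<in> multiples m \<and> b \<in> multiples m \<and> \<bar>a - b\<bar> = int m}"

section \<open>The simplicial lattice\<close>

definition nvec :: "real ^ 'n" where
  "nvec = (\<Sum>i\<in>UNIV. axis i 1)"

definition hyperplane :: "(real ^ 'n) set" where
  "hyperplane = {v. v \<bullet> nvec = 0}"

definition hproj :: "real ^ 'n \<Rightarrow> real ^ 'n" where
  "hproj v = v - ((v \<bullet> nvec) / ((nvec :: real ^ 'n) \<bullet> nvec)) *\<^sub>R nvec"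

lemma nvec_nth [simp]: "nvec $ i = 1"
  by (simp add: nvec_def axis_def)

lemma nvec_inner_nvec: "(nvec :: real ^ 'n) \<bullet> nvec = real CARD('n)"
  by (simp add: inner_vec_def)

text \<open>The map \<open>hproj\<close> is the orthogonal projection onto the hyperplane.\<close>

lemma hproj_in_hyperplane: "hproj v \<in> hyperplane"
  by (simp add: hproj_def hyperplane_def inner_diff_left nvec_inner_nvec)

lemma hproj_orthogonal: "w \<in> hyperplane \<Longrightarrow> (v - hproj v) \<bullet> w = 0"
  by (simp add: hproj_def hyperplane_def inner_commute)

definition gvec :: "'n \<Rightarrow> real ^ 'n" where
  "gvec i = hproj (axis i 1)"

lemma gvec_eq: "gvec (i :: 'n::finite) = axis i 1 - (1 / real CARD('n)) *\<^sub>R nvec"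
  by (simp add: gvec_def hproj_def nvec_inner_nvec inner_axis')

definition lattice_points :: "(real ^ 'n) set" where
  "lattice_points = hproj ` {z. \<forall>i. z $ i \<in> \<int>}"

definition lattice_edges :: "(real ^ 'n) set set" where
  "lattice_edges = {{x, x + gvec i} | x i. x \<in> lattice_points}"

text \<open>
  Only \<open>s 0, \<dots>, s (d + 1)\<close> matter. The path is automatically closed, because the \<open>gvec i\<close> sum to 0.
\<close>

definition simplicial_loop :: "(nat \<Rightarrow> real ^ 'n) \<Rightarrow> bool" where
  "simplicial_loop s \<longleftrightarrow> s 0 \<in> lattice_points \<and>
     (\<exists>\<xi>. bij_betw \<xi> {1..CARD('n)} (UNIV :: 'n set) \<and>
          (\<forall>k \<in> {1..CARD('n)}. s k = s (k - 1) + gvec (\<xi> k)))"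

definition loop_edges :: "(nat \<Rightarrow> real ^ 'n) \<Rightarrow> (real ^ 'n) set set" where
  "loop_edges s = {{s (k - 1), s k} | k. k \<in> {1..CARD('n)}}"

section \<open>Height functions\<close>

text \<open>
  Height functions live on \<open>lattice_points\<close>; being extensional, they are determined by their
  values there.
\<close>

definition height_functions :: "(real ^ 'n \<Rightarrow> int) set" where
  "height_functions = {f \<in> extensional lattice_points.
     f 0 \<in> multiples CARD('n) \<and>
     (\<forall>x \<in> lattice_points. \<forall>i. f (x + gvec i) - f x \<in> {1, - int (CARD('n) - 1)})}"

definition tiling_of :: "(real ^ 'n \<Rightarrow> int) \<Rightarrow> (real ^ 'n) set set" where
  "tiling_of f = {{x, x + gvec i} | x i.
     x \<in> lattice_points \<and> f (x + gvec i) - f x = - int (CARD('n) - 1)}"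

definition Phi :: "(real ^ 'n \<Rightarrow> int) \<Rightarrow> int \<times> (real ^ 'n) set set" where
  "Phi f = (f 0, tiling_of f)"

section \<open>Boundaries and level sets\<close>

definition fdiff :: "(real ^ 'n \<Rightarrow> int) \<Rightarrow> (real ^ 'n \<Rightarrow> int) \<Rightarrow> real ^ 'n \<Rightarrow> int" where
  "fdiff f1 f2 = (\<lambda>x. f1 x - f2 x)"

definition jump_edges :: "(real ^ 'n \<Rightarrow> int) \<Rightarrow> (real ^ 'n) set set" where
  "jump_edges g = {e \<in> lattice_edges. \<not> g constant_on e}"

definition boundary_graph_edges :: "(real ^ 'n \<Rightarrow> int) \<Rightarrow> (real ^ 'n) set set set" where
  "boundary_graph_edges g = {{e, e'} | e e'. e \<in> jump_edges g \<and> e' \<in> jump_edges g \<and> e \<noteq> e' \<and>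
     (\<exists>s. simplicial_loop s \<and> e \<in> loop_edges s \<and> e' \<in> loop_edges s)}"

definition boundaries :: "(real ^ 'n \<Rightarrow> int) \<Rightarrow> (real ^ 'n) set set set" where
  "boundaries g = graph_components (jump_edges g) (boundary_graph_edges g)"

definition level_sets :: "(real ^ 'n \<Rightarrow> int) \<Rightarrow> (real ^ 'n) set set" where
  "level_sets g = graph_components lattice_points (lattice_edges - jump_edges g)"

definition level_set_containing ::
    "(real ^ 'n \<Rightarrow> int) \<Rightarrow> (real ^ 'n) set \<Rightarrow> (real ^ 'n) set" where
  "level_set_containing g S = (THE A. A \<in> level_sets g \<and> S \<subseteq> A)"

definition xminus :: "(real ^ 'n \<Rightarrow> int) \<Rightarrow> (real ^ 'n) set \<Rightarrow> real ^ 'n" where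
  "xminus g e = arg_min_on g e"

definition xplus :: "(real ^ 'n \<Rightarrow> int) \<Rightarrow> (real ^ 'n) set \<Rightarrow> real ^ 'n" where
  "xplus g e = arg_max_on g e"

text \<open>
  The restriction of \<open>ends\<close> to the edge set makes equality of records the same as equality of graphs.
\<close>

definition LSD :: "(real ^ 'n \<Rightarrow> int) \<Rightarrow> ((real ^ 'n) set, (real ^ 'n) set set) mgraph" where
  "LSD g = \<lparr> verts = level_sets g, edges = boundaries g,
     ends = (\<lambda>E \<in> boundaries g. {level_set_containing g (xminus g ` E),
                                  level_set_containing g (xplus g ` E)}) \<rparr>"

text \<open>
  The function induced by \<open>g\<close> on the vertices of \<open>LSD g\<close>, on each of which \<open>g\<close> is constant.
\<close>

definition level_function :: "(real ^ 'n \<Rightarrow> int) \<Rightarrow> (real ^ 'n) set \<Rightarrow> int" where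
  "level_function g = (\<lambda>A \<in> level_sets g. the_elem (g ` A))"

section \<open>Cluster boundary swaps\<close>

definition cluster_swap ::
    "(real ^ 'n \<Rightarrow> int) \<times> (real ^ 'n \<Rightarrow> int) \<Rightarrow> (real ^ 'n) set set
      \<Rightarrow> (real ^ 'n \<Rightarrow> int) \<times> (real ^ 'n \<Rightarrow> int)" where
  "cluster_swap = (\<lambda>(f1, f2) M.
     (inv_into height_functions Phi (f1 0, sym_diff (tiling_of f1) M),
      inv_into height_functions Phi (f2 0, sym_diff (tiling_of f2) M)))"

definition swap_rel ::
    "((real ^ 'n \<Rightarrow> int) \<times> (real ^ 'n \<Rightarrow> int)) rel" where
  "swap_rel = {((f1, f2), p). f1 \<in> height_functions \<and> f2 \<in> height_functions \<and>
     (\<exists>\<C> \<subseteq> boundaries (fdiff f1 f2). p = cluster_swap (f1, f2) (\<Union>\<C>))}"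

end

theory Submission
  imports Defs
begin

text \<open>
  Let \<open>g = f1 - f2\<close>. A simplicial loop meets either none or exactly two edges on which \<open>g\<close> jumps,
  and any two such edges lie in the same boundary. Hence, if \<open>M\<close> is a union of boundaries, the
  1-cochain which agrees with the increments of \<open>g\<close> on \<open>M\<close> and vanishes elsewhere sums to 0 along
  every simplicial loop, so it is the gradient of a function \<open>h\<close>. The swap along \<open>M\<close> replaces
  \<open>(f1, f2)\<close> by \<open>(f1 - h, f2 + h)\<close>, thereby reversing the sign of the increments of \<open>g\<close> exactly
  on \<open>M\<close>; in particular level sets and boundaries do not change. Conversely, the two jumps of a
  loop cut it into two arcs on which \<open>g\<close> is constant, so all edges of a boundary join the same two
  level sets in the same direction. Hence every homomorphism from the level set graph picks one
  sign for each boundary, and these signs are realised by a swap.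
\<close>

section \<open>Connected components as classes of an equivalence relation\<close>

section \<open>Components of graphs\<close>

text \<open>Named separately so that the library facts about \<open>equiv\<close> and quotients
  apply to \<open>graph_components\<close>.\<close>

definition connected_rel :: "'v set \<Rightarrow> 'v set set \<Rightarrow> ('v \<times> 'v) set" where
  "connected_rel V E = {(x, y). x \<in> V \<and> y \<in> V \<and> (x, y) \<in> {(u, v). {u, v} \<in> E}\<^sup>*}"

lemma equiv_connected_rel: "equiv V (connected_rel V E)"
proof (rule equivI)
  have "sym {(u, v). {u, v} \<in> E}"
    by (auto simp: sym_def insert_commute)
  then have "sym ({(u, v). {u, v} \<in> E}\<^sup>*)"
    by (rule sym_rtrancl)
  then show "sym (connected_rel V E)"
    by (auto simp: connected_rel_def sym_def)
  show "trans (connected_rel V E)"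
    by (auto simp: connected_rel_def trans_def)
qed (auto simp: connected_rel_def refl_on_def)

lemma graph_components_eq: "graph_components V E = V // connected_rel V E"
  by (simp add: graph_components_def connected_rel_def)

lemma Union_graph_components: "\<Union> (graph_components V E) = V"
  by (simp add: graph_components_eq Union_quotient equiv_connected_rel)

lemma graph_component_unique:
  assumes "A \<in> graph_components V E" "B \<in> graph_components V E" "x \<in> A" "x \<in> B"
  shows "A = B"
  using quotient_disj[OF equiv_connected_rel assms(1,2)[unfolded graph_components_eq]] assms(3,4)
  by blast

lemma graph_component_nonempty: "A \<in> graph_components V E \<Longrightarrow> A \<noteq> {}"
  unfolding graph_components_eq by (rule in_quotient_imp_non_empty[OF equiv_connected_rel])

lemma graph_component_edge:
  assumes "A \<in> graph_components V E" "x \<in> A" "y \<in> V" "{x, y} \<in> E"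
  shows "y \<in> A"
proof -
  have "x \<in> V"
    using assms(1,2) Union_graph_components[of V E] by blast
  then have "(x, y) \<in> connected_rel V E"
    using assms(3,4) by (simp add: connected_rel_def r_into_rtrancl)
  then show ?thesis
    by (rule in_quotient_imp_closed[OF equiv_connected_rel assms(1,2)[unfolded graph_components_eq]])
qed

text \<open>Reduces constancy on a component to a check along single edges. It is used twice: for
  \<open>g\<close> itself on level sets, and for \<open>edge_sides\<close> on boundaries.\<close>

lemma graph_component_invariant:
  assumes A: "A \<in> graph_components V E" "x \<in> A" "y \<in> A"
    and h: "\<And>u v. {u, v} \<in> E \<Longrightarrow> h u = h v"
  shows "h x = h y"
proof -
  have "(x, y) \<in> connected_rel V E"
    using A(2,3)
    by (intro in_quotient_imp_in_rel[OF equiv_connected_rel A(1)[unfolded graph_components_eq]]) simp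
  then have "(x, y) \<in> {(u, v). {u, v} \<in> E}\<^sup>*"
    by (simp add: connected_rel_def)
  then show ?thesis
    by (induction rule: rtrancl_induct) (use h in auto)
qed

section \<open>Discrete integration of closed 1-cochains on the integer grid\<close>

section \<open>Potentials on the integer grid\<close>

text \<open>The discrete antiderivative normalised at 0. The sign in the second branch makes
  \<open>antidiff_step\<close> hold across 0 and for negative arguments.\<close>

definition antidiff :: "(int \<Rightarrow> int) \<Rightarrow> int \<Rightarrow> int" where
  "antidiff a k = (if 0 \<le> k then \<Sum>m\<in>{0..<k}. a m else - (\<Sum>m\<in>{k..<0}. a m))"

lemma antidiff_0: "antidiff a 0 = 0"
  by (simp add: antidiff_def)

lemma antidiff_step: "antidiff a (k + 1) - antidiff a k = a k"
proof (cases "0 \<le> k")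
  case True
  then have "{0..<k + 1} = insert k {0..<k}"
    by auto
  then show ?thesis
    using True by (simp add: antidiff_def)
next
  case False
  then have *: "{k..<0} = insert k {k + 1..<0}"
    by auto
  have "antidiff a (k + 1) = - (\<Sum>m\<in>{k + 1..<0}. a m)"
    using False by (auto simp: antidiff_def)
  then show ?thesis
    using False * by (simp add: antidiff_def)
qed

lemma int_step_constant:
  fixes a :: "int \<Rightarrow> 'b"
  assumes "\<And>k. a (k + 1) = a k"
  shows "a k = a 0"
proof (induction k rule: int_induct[where k = 0])
  case (step2 i)
  then show ?case
    using assms[of "i - 1"] by simp
qed (use assms in auto)

text \<open>Coordinates are moved to 0 one at a time: the induction is over a finite set outside
  which the point already vanishes.\<close>

lemma grid_step_constant:
  fixes F :: "('a::finite \<Rightarrow> int) \<Rightarrow> 'b"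
  assumes step: "\<And>z i. F (z(i := z i + 1)) = F z"
  shows "F z = F (\<lambda>_. 0)"
proof -
  have "\<forall>z. (\<forall>i. i \<notin> S \<longrightarrow> z i = 0) \<longrightarrow> F z = F (\<lambda>_. 0)" if "finite S" for S
    using that
  proof (induction S rule: finite_induct)
    case empty
    show ?case
    proof (intro allI impI)
      fix z :: "'a \<Rightarrow> int"
      assume "\<forall>i. i \<notin> {} \<longrightarrow> z i = 0"
      then have "z = (\<lambda>_. 0)"
        by auto
      then show "F z = F (\<lambda>_. 0)"
        by simp
    qed
  next
    case (insert j S)
    show ?case
    proof (intro allI impI)
      fix z :: "'a \<Rightarrow> int"
      assume z: "\<forall>i. i \<notin> insert j S \<longrightarrow> z i = 0"
      have "F (z(j := k + 1)) = F (z(j := k))" for k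
        using step[of "z(j := k)" j] by simp
      then have "F (z(j := z j)) = F (z(j := 0))"
        by (rule int_step_constant)
      also have "\<dots> = F (\<lambda>_. 0)"
        by (rule insert.IH[rule_format]) (use z in simp)
      finally show "F z = F (\<lambda>_. 0)"
        by simp
    qed
  qed
  from this[of UNIV] show ?thesis
    by simp
qed

text \<open>A discrete Poincare lemma: closedness around unit squares suffices for integration. The
  induction is over the set \<open>S\<close> of directions in which the gradient is already correct.
  For a new direction \<open>j\<close>, the old potential is kept on the slice where coordinate
  \<open>j\<close> is 0, and \<open>c\<close> is integrated along \<open>j\<close> away from
  it.\<close>

lemma grid_potential:
  fixes c :: "('a::finite \<Rightarrow> int) \<Rightarrow> 'a \<Rightarrow> int"
  assumes square: "\<And>z i j. i \<noteq> j \<Longrightarrow>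
    c z i + c (z(i := z i + 1)) j = c z j + c (z(j := z j + 1)) i"
  obtains F where "\<And>z i. F (z(i := z i + 1)) - F z = c z i"
proof -
  have "\<exists>F. \<forall>z. \<forall>i\<in>S. F (z(i := z i + 1)) - F z = c z i" if "finite S" for S
    using that
  proof (induction S rule: finite_induct)
    case (insert j S)
    then obtain F where F: "\<And>z i. i \<in> S \<Longrightarrow> F (z(i := z i + 1)) - F z = c z i"
      by blast
    define G where "G z = F (z(j := 0)) + antidiff (\<lambda>k. c (z(j := k)) j) (z j)" for z
    have Gj: "G (z(j := z j + 1)) - G z = c z j" for z
      using antidiff_step[of "\<lambda>k. c (z(j := k)) j" "z j"] by (simp add: G_def)
    have Gi: "G (z(i := z i + 1)) - G z = c z i" if "i \<in> S" for z i
    proof -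
      have ij: "i \<noteq> j"
        using that insert.hyps by auto
      \<comment> \<open>\<open>D k\<close> is the error in direction \<open>i\<close> after moving
        coordinate \<open>j\<close> to \<open>k\<close>. The square condition makes it independent
        of \<open>k\<close>, and on the slice \<open>k = 0\<close> it vanishes by the choice of
        \<open>F\<close>.\<close>
      define D where "D k = G (z(j := k, i := z i + 1)) - G (z(j := k)) - c (z(j := k)) i" for k
      have "D (k + 1) = D k" for k
        using Gj[of "z(j := k)"] Gj[of "z(j := k, i := z i + 1)"] square[of i j "z(j := k)"] ij
        by (simp add: D_def fun_upd_twist)
      then have "D (z j) = D 0"
        by (rule int_step_constant)
      also have "D 0 = 0"
        using F[OF that, of "z(j := 0)"] ij by (simp add: D_def G_def antidiff_0 fun_upd_twist)
      finally show ?thesis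
        by (simp add: D_def)
    qed
    show ?case
      using Gj Gi by blast
  qed simp
  from this[of UNIV] show ?thesis
    using that by auto
qed

section \<open>Integer coordinates on the lattice, and its edges\<close>

section \<open>The simplicial lattice\<close>

definition lattice_map :: "('n \<Rightarrow> int) \<Rightarrow> real ^ 'n::finite" where
  "lattice_map z = (\<Sum>i\<in>UNIV. of_int (z i) *\<^sub>R gvec i)"

lemma gvec_nth: "gvec (i :: 'n::finite) $ j = (if i = j then 1 else 0) - 1 / real CARD('n)"
  by (simp add: gvec_eq axis_def)

lemma lattice_map_nth:
  "lattice_map z $ (j :: 'n::finite) = of_int (z j) - of_int (\<Sum>i\<in>UNIV. z i) / real CARD('n)"
proof -
  have "of_int (z i) * gvec i $ j = (if i = j then of_int (z j) else 0) - of_int (z i) / real CARD('n)"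
    for i
    by (simp add: gvec_nth right_diff_distrib)
  then show ?thesis
    by (simp add: lattice_map_def sum_subtractf sum_divide_distrib)
qed

lemma hproj_nth: "hproj v $ (j :: 'n::finite) = v $ j - (\<Sum>i\<in>UNIV. v $ i) / real CARD('n)"
  by (simp add: hproj_def nvec_inner_nvec) (simp add: inner_vec_def)

lemma lattice_points_eq: "lattice_points = range (lattice_map :: _ \<Rightarrow> real ^ 'n::finite)"
proof (rule set_eqI, rule iffI)
  fix x :: "real ^ 'n"
  assume "x \<in> lattice_points"
  then obtain v where v: "x = hproj v" "\<And>i. v $ i \<in> \<int>"
    by (auto simp: lattice_points_def)
  have "x = lattice_map (\<lambda>i. \<lfloor>v $ i\<rfloor>)"
    using v by (simp add: vec_eq_iff hproj_nth lattice_map_nth)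
  then show "x \<in> range lattice_map"
    by blast
next
  fix x :: "real ^ 'n"
  assume "x \<in> range lattice_map"
  then obtain z where "x = lattice_map z"
    by blast
  then have "x = hproj (\<chi> i. of_int (z i))"
    by (simp add: vec_eq_iff hproj_nth lattice_map_nth)
  then show "x \<in> lattice_points"
    by (auto simp: lattice_points_def)
qed

lemma lattice_map_upd: "lattice_map (z(i := z i + 1)) = lattice_map z + gvec i"
proof -
  have "lattice_map (z(i := z i + 1)) - lattice_map z =
      (\<Sum>j\<in>UNIV. (if j = i then gvec i else 0))"
    unfolding lattice_map_def sum_subtractf[symmetric]
    by (intro sum.cong) (auto simp: scaleR_left_diff_distrib[symmetric])
  then show ?thesis
    by (simp add: algebra_simps)
qed

text \<open>The projection subtracts the same mean from every coordinate, so differences of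
  coordinates survive it. Hence the fibres of \<open>lattice_map\<close> are orbits of the diagonal
  shift.\<close>

lemma lattice_map_eqD:
  fixes z w :: "'n::finite \<Rightarrow> int"
  assumes "lattice_map z = lattice_map w"
  obtains k where "z = (\<lambda>i. w i + k)"
proof -
  have *: "real_of_int (z i) - z j = w i - w j" for i j
    using arg_cong[OF assms, of "\<lambda>v. v $ i - v $ j"] by (simp add: lattice_map_nth)
  have "z i - z j = w i - w j" for i j
    using *[of i j] by linarith
  \<comment> \<open>Here \<open>undefined\<close> only stands for some fixed index, at which the
    common shift is read off.\<close>
  then have "z i = w i + (z undefined - w undefined)" for i
    by (simp add: algebra_simps)
  then have "z = (\<lambda>i. w i + (z undefined - w undefined))"
    by blast
  then show ?thesis
    by (rule that)
qed

lemma zero_in_lattice: "0 \<in> lattice_points"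
  unfolding lattice_points_eq by (intro range_eqI[of _ _ "\<lambda>_. 0"]) (simp add: lattice_map_def)

lemma gvec_step_in_lattice: "x \<in> lattice_points \<Longrightarrow> x + gvec i \<in> lattice_points"
  unfolding lattice_points_eq using lattice_map_upd by (metis imageE rangeI)

lemma sum_gvec: "(\<Sum>i\<in>(UNIV :: 'n::finite set). gvec i) = 0"
  by (simp add: vec_eq_iff gvec_nth sum_subtractf)

abbreviation incr :: "(real ^ 'n::finite \<Rightarrow> int) \<Rightarrow> real ^ 'n \<Rightarrow> 'n \<Rightarrow> int" where
  "incr f x i \<equiv> f (x + gvec i) - f x"

lemma lattice_step_constant:
  fixes F :: "real ^ 'n::finite \<Rightarrow> 'b"
  assumes step: "\<And>x i. x \<in> lattice_points \<Longrightarrow> F (x + gvec i) = F x" and x: "x \<in> lattice_points"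
  shows "F x = F 0"
proof -
  obtain z where z: "x = lattice_map z"
    using x by (auto simp: lattice_points_eq)
  have "F (lattice_map (w(i := w i + 1))) = F (lattice_map w)" for w :: "'n \<Rightarrow> int" and i
    unfolding lattice_map_upd by (rule step) (simp add: lattice_points_eq)
  then have "F (lattice_map z) = F (lattice_map (\<lambda>_. 0))"
    by (rule grid_step_constant[of "\<lambda>w. F (lattice_map w)"])
  then show ?thesis
    using z by (simp add: lattice_map_def)
qed

lemma lattice_fun_eqI:
  fixes a b :: "real ^ 'n::finite \<Rightarrow> int"
  assumes incr: "\<And>x i. x \<in> lattice_points \<Longrightarrow> incr a x i = incr b x i"
    and "a 0 = b 0" "x \<in> lattice_points"
  shows "a x = b x"
proof -
  have "a (y + gvec i) - b (y + gvec i) = a y - b y" if "y \<in> lattice_points" for y i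
    using incr[OF that, of i] by simp
  then have "a x - b x = a 0 - b 0"
    using lattice_step_constant[of "\<lambda>y. a y - b y"] assms(3) by blast
  then show ?thesis
    using assms(2) by simp
qed

text \<open>This is where d \<ge> 2 enters. Reading an edge backwards would require
  \<open>gvec i + gvec j = 0\<close>, but at a third index \<open>k\<close> this sum has the entry
  -2/(d+1). With only two coordinates the two generators are opposite and an edge has two
  readings.\<close>

lemma lattice_edge_inject:
  fixes x y :: "real ^ 'n::finite"
  assumes card: "3 \<le> CARD('n)" and eq: "{x, x + gvec i} = {y, y + gvec j}"
  shows "x = y \<and> i = j"
proof -
  from eq have "x = y \<and> x + gvec i = y + gvec j \<or> x = y + gvec j \<and> x + gvec i = y"
    by (simp only: doubleton_eq_iff)
  then show ?thesis
  proof
    assume 1: "x = y \<and> x + gvec i = y + gvec j"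
    then have "x + gvec i = x + gvec j"
      by metis
    then have "(gvec i :: real ^ 'n) = gvec j"
      by (rule add_left_imp_eq)
    then have "(gvec i :: real ^ 'n) $ i = gvec j $ i"
      by (rule arg_cong)
    then show ?thesis
      using conjunct1[OF 1] by (simp add: gvec_nth split: if_splits)
  next
    assume 2: "x = y + gvec j \<and> x + gvec i = y"
    then have "y + (gvec i + gvec j) = y + 0"
      by (metis add.assoc add.commute add_0_right)
    then have 0: "gvec i + gvec j = (0 :: real ^ 'n)"
      by (rule add_left_imp_eq)
    have "card {i, j} \<le> 2"
      by (cases "i = j") simp_all
    then have "{i, j} \<noteq> UNIV"
      using card by auto
    then obtain k where k: "k \<noteq> i" "k \<noteq> j"
      by blast
    have "(gvec i + gvec j :: real ^ 'n) $ k = 0"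
      unfolding 0 by simp
    then show ?thesis
      using k by (simp add: gvec_nth)
  qed
qed

section \<open>Loops as orderings of the directions, and cochains summing to 0 along them\<close>

section \<open>Simplicial loops\<close>

text \<open>A simplicial loop with its permutation exposed, since increments along the loop are
  indexed by the directions \<open>\<xi> k\<close>.\<close>

definition loop_along :: "(nat \<Rightarrow> real ^ 'n::finite) \<Rightarrow> (nat \<Rightarrow> 'n) \<Rightarrow> bool" where
  "loop_along s \<xi> \<longleftrightarrow> s 0 \<in> lattice_points \<and> bij_betw \<xi> {1..CARD('n)} UNIV \<and>
     (\<forall>k \<in> {1..CARD('n)}. s k = s (k - 1) + gvec (\<xi> k))"

lemma simplicial_loop_iff: "simplicial_loop s \<longleftrightarrow> (\<exists>\<xi>. loop_along s \<xi>)"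
  by (auto simp: simplicial_loop_def loop_along_def)

lemma loop_along_step:
  "loop_along (s :: nat \<Rightarrow> real ^ 'n::finite) \<xi> \<Longrightarrow> k \<in> {1..CARD('n)} \<Longrightarrow>
    s k = s (k - 1) + gvec (\<xi> k)"
  by (simp add: loop_along_def)

lemma loop_along_in_lattice:
  assumes "loop_along (s :: nat \<Rightarrow> real ^ 'n::finite) \<xi>" "k \<le> CARD('n)"
  shows "s k \<in> lattice_points"
  using assms(2)
proof (induction k)
  case 0
  then show ?case
    using assms by (simp add: loop_along_def)
next
  case (Suc k)
  then show ?case
    using loop_along_step[OF assms(1), of "Suc k"] gvec_step_in_lattice by simp
qed

lemma loop_along_sum:
  assumes "loop_along (s :: nat \<Rightarrow> real ^ 'n::finite) \<xi>" "k \<le> CARD('n)"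
  shows "s k = s 0 + (\<Sum>m\<in>{1..k}. gvec (\<xi> m))"
  using assms(2)
proof (induction k)
  case (Suc k)
  then show ?case
    using loop_along_step[OF assms(1), of "Suc k"] by (simp add: algebra_simps)
qed simp

lemma loop_along_closed:
  assumes "loop_along (s :: nat \<Rightarrow> real ^ 'n::finite) \<xi>"
  shows "s CARD('n) = s 0"
proof -
  have "(\<Sum>m\<in>{1..CARD('n)}. gvec (\<xi> m)) = (\<Sum>i\<in>UNIV. gvec i :: real ^ 'n)"
    using assms by (intro sum.reindex_bij_betw) (simp add: loop_along_def)
  then show ?thesis
    using loop_along_sum[OF assms, of "CARD('n)"] by (simp add: sum_gvec)
qed

lemma loop_along_construct:
  assumes "x \<in> lattice_points" "bij_betw \<xi> {1..CARD('n)} UNIV"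
  shows "loop_along (\<lambda>k. x + (\<Sum>m\<in>{1..k}. gvec (\<xi> m)) :: real ^ 'n::finite) \<xi>"
proof -
  have "(\<Sum>m\<in>{1..k}. gvec (\<xi> m)) = (\<Sum>m\<in>{1..k - 1}. gvec (\<xi> m)) + (gvec (\<xi> k) :: real ^ 'n)"
    if "1 \<le> k" for k
    using that by (cases k) auto
  then show ?thesis
    using assms by (auto simp: loop_along_def)
qed

lemma sum_incr_path:
  fixes g :: "'a \<Rightarrow> int"
  shows "(\<Sum>k\<in>{1..n}. g (s k) - g (s (k - 1))) = g (s n) - g (s (0 :: nat))"
  by (induction n) auto

lemma sum_incr_loop:
  assumes "loop_along (s :: nat \<Rightarrow> real ^ 'n::finite) \<xi>"
  shows "(\<Sum>k\<in>{1..CARD('n)}. incr g (s (k - 1)) (\<xi> k)) = 0"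
proof -
  have "(\<Sum>k\<in>{1..CARD('n)}. incr g (s (k - 1)) (\<xi> k)) =
      (\<Sum>k\<in>{1..CARD('n)}. g (s k) - g (s (k - 1)))"
    by (intro sum.cong) (auto simp: loop_along_step[OF assms])
  also have "\<dots> = 0"
    by (simp only: sum_incr_path loop_along_closed[OF assms] diff_self)
  finally show ?thesis .
qed

text \<open>Supplies two loops that agree from the third step on and pass around a unit square on
  different sides. Subtracting their sums yields the square condition of
  \<open>grid_potential\<close>.\<close>

lemma enumeration_starting_with:
  fixes i j :: "'n::finite"
  assumes "i \<noteq> j"
  obtains b where "bij_betw (\<lambda>k::nat. if k = 1 then i else if k = 2 then j else b k) {1..CARD('n)} UNIV"
    and "bij_betw (\<lambda>k::nat. if k = 1 then j else if k = 2 then i else b k) {1..CARD('n)} UNIV"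
proof -
  have ge: "2 \<le> CARD('n)"
    using card_mono[of UNIV "{i, j}"] assms by simp
  have "card {3..CARD('n)} = card (UNIV - {i, j})"
    using assms by (simp add: card_Diff_subset)
  then obtain b where b: "bij_betw b {3..CARD('n)} (UNIV - {i, j})"
    using finite_same_card_bij[of "{3..CARD('n)}" "UNIV - {i, j}"] by auto
  have "bij_betw (\<lambda>k::nat. if k = 1 then p else if k = 2 then q else b k) {1..CARD('n)} UNIV"
    if pq: "{p, q} = {i, j}" for p q
  proof -
    let ?\<xi> = "\<lambda>k::nat. if k = 1 then p else if k = 2 then q else b k"
    have "p \<noteq> q"
      using pq assms by auto
    then have 1: "bij_betw ?\<xi> {1, 2} {p, q}"
      by (auto simp: bij_betw_def inj_on_def)
    have 2: "bij_betw ?\<xi> {3..CARD('n)} (UNIV - {p, q})"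
      using b pq by (subst bij_betw_cong[of _ _ b]) auto
    have "bij_betw ?\<xi> ({1, 2} \<union> {3..CARD('n)}) ({p, q} \<union> (UNIV - {p, q}))"
      by (rule bij_betw_combine[OF 1 2]) auto
    moreover have "{1, 2} \<union> {3..CARD('n)} = {1..CARD('n)}"
      using ge by auto
    ultimately show ?thesis
      by simp
  qed
  then show ?thesis
    using that[of b] by blast
qed

text \<open>Loops play two roles. Comparing two of them gives closedness around squares, hence a
  potential \<open>F\<close> on the integer grid. A single loop lifts to a path from
  \<open>z\<close> to \<open>z\<close> plus the all-ones vector, so \<open>F\<close> is invariant
  under the diagonal shift and descends to the lattice.\<close>

lemma lattice_potential:
  fixes c :: "real ^ 'n::finite \<Rightarrow> 'n \<Rightarrow> int"
  assumes loop: "\<And>s \<xi>. loop_along s \<xi> \<Longrightarrow> (\<Sum>k\<in>{1..CARD('n)}. c (s (k - 1)) (\<xi> k)) = 0"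
  obtains h where "\<forall>x\<in>lattice_points. \<forall>i. incr h x i = c x i" "h 0 = 0"
proof -
  have square: "c x i + c (x + gvec i) j = c x j + c (x + gvec j) i"
    if x: "x \<in> lattice_points" and ij: "i \<noteq> j" for x i j
  proof -
    obtain b where b:
      "bij_betw (\<lambda>k::nat. if k = 1 then i else if k = 2 then j else b k) {1..CARD('n)} UNIV"
      "bij_betw (\<lambda>k::nat. if k = 1 then j else if k = 2 then i else b k) {1..CARD('n)} UNIV"
      using enumeration_starting_with[OF ij] .
    have ge: "2 \<le> CARD('n)"
      using card_mono[of UNIV "{i, j}"] ij by simp
    \<comment> \<open>The contribution of the steps from the third on, common to both loops because
      they meet again at \<open>x + gvec i + gvec j\<close>.\<close>
    define R where "R = (\<Sum>k\<in>{3..CARD('n)}.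
      c (x + gvec i + gvec j + (\<Sum>m\<in>{3..k - 1}. gvec (b m))) (b k))"
    have *: "c x p + c (x + gvec p) q + R = 0"
      if bij: "bij_betw (\<lambda>k::nat. if k = 1 then p else if k = 2 then q else b k) {1..CARD('n)} UNIV"
        and pq: "gvec p + gvec q = (gvec i + gvec j :: real ^ 'n)" for p q
    proof -
      define \<xi> where "\<xi> k = (if k = 1 then p else if k = 2 then q else b k)" for k :: nat
      define s where "s k = x + (\<Sum>m\<in>{1..k}. gvec (\<xi> m))" for k :: nat
      have "loop_along s \<xi>"
        unfolding s_def using x bij by (intro loop_along_construct) (auto simp: \<xi>_def[abs_def])
      then have 0: "(\<Sum>k\<in>{1..CARD('n)}. c (s (k - 1)) (\<xi> k)) = 0"
        by (rule loop)
      have "c (s (k - 1)) (\<xi> k) =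
          c (x + gvec i + gvec j + (\<Sum>m\<in>{3..k - 1}. gvec (b m))) (b k)" if "3 \<le> k" for k
      proof -
        have "{1..k - 1} = insert 1 (insert 2 {3..k - 1})"
          using that by auto
        then have "s (k - 1) = x + (gvec p + gvec q) + (\<Sum>m\<in>{3..k - 1}. gvec (\<xi> m))"
          by (simp add: s_def \<xi>_def add.assoc)
        also have "(\<Sum>m\<in>{3..k - 1}. gvec (\<xi> m)) = (\<Sum>m\<in>{3..k - 1}. gvec (b m) :: real ^ 'n)"
          by (intro sum.cong) (auto simp: \<xi>_def)
        finally show ?thesis
          using that pq by (simp add: \<xi>_def add.assoc)
      qed
      then have "R = (\<Sum>k\<in>{3..CARD('n)}. c (s (k - 1)) (\<xi> k))"
        unfolding R_def by (intro sum.cong) auto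
      moreover have "{1..CARD('n)} = insert 1 (insert 2 {3..CARD('n)})"
        using ge by auto
      ultimately show ?thesis
        using 0 by (simp add: s_def \<xi>_def)
    qed
    show ?thesis
      using *[OF b(1)] *[OF b(2)] by (simp add: add.commute)
  qed
  have in_lattice: "lattice_map z \<in> lattice_points" for z :: "'n \<Rightarrow> int"
    by (simp add: lattice_points_eq)
  obtain F where F: "\<And>z i. F (z(i := z i + 1)) - F z = c (lattice_map z) i"
    using grid_potential[of "\<lambda>z. c (lattice_map z)"] square[OF in_lattice]
    by (metis lattice_map_upd)
  have period: "F (\<lambda>i. z i + 1) = F z" for z
  proof -
    obtain \<xi> :: "nat \<Rightarrow> 'n" where \<xi>: "bij_betw \<xi> {1..CARD('n)} UNIV"
      using ex_bij_betw_nat_finite_1[of "UNIV :: 'n set"] by auto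
    define s where "s k = lattice_map z + (\<Sum>m\<in>{1..k}. gvec (\<xi> m))" for k :: nat
    \<comment> \<open>The lift of \<open>s k\<close> to the grid: each direction used in the first
      \<open>k\<close> steps is raised by one. At \<open>k = CARD('n)\<close> all of them
      are.\<close>
    define w where "w k = (\<lambda>i. z i + (if i \<in> \<xi> ` {1..k} then 1 else 0))" for k :: nat
    have s: "loop_along s \<xi>"
      unfolding s_def using \<xi> in_lattice by (intro loop_along_construct)
    have w_Suc: "w k = (w (k - 1))(\<xi> k := w (k - 1) (\<xi> k) + 1)" if k: "k \<in> {1..CARD('n)}" for k
    proof -
      have "{1..k} = insert k {1..k - 1}"
        using k by auto
      then have 1: "\<xi> ` {1..k} = insert (\<xi> k) (\<xi> ` {1..k - 1})"
        by simp
      have "\<xi> k \<notin> \<xi> ` {1..k - 1}"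
      proof
        assume "\<xi> k \<in> \<xi> ` {1..k - 1}"
        then obtain m where m: "m \<in> {1..k - 1}" "\<xi> k = \<xi> m"
          by auto
        then have "k = m"
          using \<xi> k by (intro inj_onD[of \<xi> "{1..CARD('n)}"]) (auto simp: bij_betw_def)
        then show False
          using m by auto
      qed
      with 1 show ?thesis
        by (auto simp: w_def fun_eq_iff)
    qed
    have sw: "s k = lattice_map (w k)" if "k \<le> CARD('n)" for k
      using that
    proof (induction k)
      case (Suc k)
      have "w (Suc k) = (w k)(\<xi> (Suc k) := w k (\<xi> (Suc k)) + 1)"
        using w_Suc[of "Suc k"] Suc.prems by simp
      then have "lattice_map (w (Suc k)) = lattice_map (w k) + gvec (\<xi> (Suc k))"
        by (simp only: lattice_map_upd)
      then show ?case
        using Suc loop_along_step[OF s, of "Suc k"] by simp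
    qed (simp add: s_def w_def)
    have "F (w k) - F (w (k - 1)) = c (s (k - 1)) (\<xi> k)" if k: "k \<in> {1..CARD('n)}" for k
    proof -
      have "F (w k) - F (w (k - 1)) = c (lattice_map (w (k - 1))) (\<xi> k)"
        by (subst w_Suc[OF k]) (rule F)
      moreover have "k - 1 \<le> CARD('n)"
        using k by auto
      ultimately show ?thesis
        by (simp only: sw)
    qed
    then have "(\<Sum>k\<in>{1..CARD('n)}. F (w k) - F (w (k - 1))) = 0"
      using loop[OF s] by simp
    then have "F (w CARD('n)) - F (w 0) = 0"
      by (simp only: sum_incr_path)
    then have "F (w CARD('n)) = F (w 0)"
      by simp
    moreover have "w CARD('n) = (\<lambda>i. z i + 1)"
      using \<xi> by (simp add: w_def bij_betw_def)
    ultimately show ?thesis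
      by (simp add: w_def)
  qed
  have F_cong: "F z = F w" if "lattice_map z = lattice_map w" for z w
  proof -
    obtain k where k: "z = (\<lambda>i. w i + k)"
      using \<open>lattice_map z = lattice_map w\<close> by (rule lattice_map_eqD)
    have "F (\<lambda>i. w i + (k + 1)) = F (\<lambda>i. w i + k)" for k
      using period[of "\<lambda>i. w i + k"] by (simp add: add.assoc)
    then have "F (\<lambda>i. w i + k) = F (\<lambda>i. w i + 0)"
      by (rule int_step_constant)
    then show ?thesis
      by (simp add: k)
  qed
  \<comment> \<open>By \<open>F_cong\<close> the chosen preimage does not matter; subtracting the
    value at the origin normalises \<open>h 0 = 0\<close>.\<close>
  define h where "h x = F (SOME z. lattice_map z = x) - F (\<lambda>_. 0)" for x :: "real ^ 'n"
  have h: "h (lattice_map z) = F z - F (\<lambda>_. 0)" for z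
    unfolding h_def using F_cong[OF someI[of "\<lambda>w. lattice_map w = lattice_map z" z]] by simp
  show ?thesis
  proof (rule that[of h], intro ballI allI)
    fix x :: "real ^ 'n" and i
    assume "x \<in> lattice_points"
    then obtain z where z: "x = lattice_map z"
      by (auto simp: lattice_points_eq)
    show "incr h x i = c x i"
      using F[of z i] by (simp add: z lattice_map_upd[symmetric] h)
  next
    show "h 0 = 0"
      using h[of "\<lambda>_. 0"] by (simp add: lattice_map_def)
  qed
qed

section \<open>Increments of height functions and of their differences\<close>

section \<open>Height functions and tilings\<close>

lemma lattice_edgeI: "x \<in> lattice_points \<Longrightarrow> {x, x + gvec i} \<in> lattice_edges"
  unfolding lattice_edges_def by blast

lemma jump_edge_iff:
  assumes "x \<in> lattice_points"
  shows "{x, x + gvec i} \<in> jump_edges g \<longleftrightarrow> incr g x i \<noteq> 0"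
proof -
  have "g constant_on {x, x + gvec i} \<longleftrightarrow> incr g x i = 0"
    by (auto simp: constant_on_def)
  then show ?thesis
    using lattice_edgeI[OF assms] by (simp add: jump_edges_def)
qed

lemma jump_edgesE:
  assumes "e \<in> jump_edges g"
  obtains x i where "x \<in> lattice_points" "e = {x, x + gvec i}" "incr g x i \<noteq> 0"
proof -
  obtain x i where "x \<in> lattice_points" "e = {x, x + gvec i}"
    using assms by (auto simp: jump_edges_def lattice_edges_def)
  then show ?thesis
    using that assms jump_edge_iff by metis
qed

lemma height_function_incr:
  fixes f :: "real ^ 'n::finite \<Rightarrow> int"
  assumes "f \<in> height_functions" "x \<in> lattice_points"
  shows "incr f x i = 1 \<or> incr f x i = 1 - int CARD('n)"
proof -
  have "int (CARD('n) - 1) = int CARD('n) - 1"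
    by (simp add: of_nat_diff Suc_leI)
  then show ?thesis
    using assms by (auto simp: height_functions_def)
qed

lemma height_functionI:
  fixes f :: "real ^ 'n::finite \<Rightarrow> int"
  assumes "f \<in> extensional lattice_points" "int CARD('n) dvd f 0"
    and "\<And>x i. x \<in> lattice_points \<Longrightarrow> incr f x i = 1 \<or> incr f x i = 1 - int CARD('n)"
  shows "f \<in> height_functions"
proof -
  have "int (CARD('n) - 1) = int CARD('n) - 1"
    by (simp add: of_nat_diff Suc_leI)
  then show ?thesis
    using assms by (auto simp: height_functions_def multiples_def)
qed

text \<open>An undirected edge could a priori belong to the tiling through another base point and
  direction; \<open>lattice_edge_inject\<close> rules this out.\<close>

lemma tiling_edge_iff:
  fixes x :: "real ^ 'n::finite"
  assumes card: "3 \<le> CARD('n)" and x: "x \<in> lattice_points"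
  shows "{x, x + gvec i} \<in> tiling_of f \<longleftrightarrow> incr f x i = 1 - int CARD('n)"
proof -
  have eq: "- int (CARD('n) - 1) = 1 - int CARD('n)"
    by (simp add: of_nat_diff Suc_leI)
  show ?thesis
  proof
    assume "{x, x + gvec i} \<in> tiling_of f"
    then obtain y j where y: "{x, x + gvec i} = {y, y + gvec j}" "incr f y j = 1 - int CARD('n)"
      unfolding tiling_of_def eq by blast
    then show "incr f x i = 1 - int CARD('n)"
      using lattice_edge_inject[OF card y(1)] by simp
  next
    assume "incr f x i = 1 - int CARD('n)"
    then show "{x, x + gvec i} \<in> tiling_of f"
      unfolding tiling_of_def eq using x by blast
  qed
qed

lemma tiling_of_subset: "tiling_of f \<subseteq> lattice_edges"
  by (auto simp: tiling_of_def lattice_edges_def)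

text \<open>The tiling decides which of the two possible increments occurs at each step, and the
  value at 0 fixes the constant. This lets \<open>inv_into\<close> in \<open>cluster_swap\<close> be
  evaluated as soon as a height function with the required image is exhibited.\<close>

lemma inj_on_Phi:
  assumes card: "3 \<le> CARD('n::finite)"
  shows "inj_on Phi (height_functions :: (real ^ 'n \<Rightarrow> int) set)"
proof (rule inj_onI)
  fix f f' :: "real ^ 'n \<Rightarrow> int"
  assume f: "f \<in> height_functions" and f': "f' \<in> height_functions" and "Phi f = Phi f'"
  then have eq: "f 0 = f' 0" "tiling_of f = tiling_of f'"
    by (auto simp: Phi_def)
  have "incr f x i = incr f' x i" if "x \<in> lattice_points" for x i
    using height_function_incr[OF f that, of i] height_function_incr[OF f' that, of i]
      tiling_edge_iff[OF card that, of i f] tiling_edge_iff[OF card that, of i f'] eq(2) by metis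
  then have "f x = f' x" if "x \<in> lattice_points" for x
    using lattice_fun_eqI that eq(1) by blast
  moreover have "f \<in> extensional lattice_points" "f' \<in> extensional lattice_points"
    using f f' by (auto simp: height_functions_def)
  ultimately show "f = f'"
    by (rule extensionalityI[rotated -1])
qed

text \<open>Each increment is 1 minus \<open>CARD('n)\<close> times the indicator of a drop. The
  \<open>CARD('n)\<close> increments sum to 0 because the loop closes, so the set \<open>K\<close>
  of drops has exactly one element.\<close>

lemma height_function_loop:
  fixes f :: "real ^ 'n::finite \<Rightarrow> int"
  assumes f: "f \<in> height_functions" and s: "loop_along s \<xi>"
  obtains k0 where "\<forall>k\<in>{1..CARD('n)}.
    incr f (s (k - 1)) (\<xi> k) = (if k = k0 then 1 - int CARD('n) else 1)"
proof -
  define K where "K = {k \<in> {1..CARD('n)}. incr f (s (k - 1)) (\<xi> k) = 1 - int CARD('n)}"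
  have incr: "incr f (s (k - 1)) (\<xi> k) = 1 - int CARD('n) * of_bool (k \<in> K)"
    if k: "k \<in> {1..CARD('n)}" for k
  proof -
    have "k - 1 \<le> CARD('n)"
      using k by auto
    then have "s (k - 1) \<in> lattice_points"
      by (rule loop_along_in_lattice[OF s])
    from height_function_incr[OF f this, of "\<xi> k"] show ?thesis
      using k by (auto simp: K_def)
  qed
  have K: "{1..CARD('n)} \<inter> K = K"
    by (auto simp: K_def)
  have "0 = (\<Sum>k\<in>{1..CARD('n)}. incr f (s (k - 1)) (\<xi> k))"
    by (rule sum_incr_loop[OF s, symmetric])
  also have "\<dots> = (\<Sum>k\<in>{1..CARD('n)}. 1 - int CARD('n) * of_bool (k \<in> K))"
    by (rule sum.cong[OF refl incr])
  also have "\<dots> = int CARD('n) - int CARD('n) * int (card K)"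
    by (simp add: sum_subtractf sum_distrib_left[symmetric] of_bool_def sum.If_cases K
        del: One_nat_def)
  finally have "int CARD('n) * (1 - int (card K)) = 0"
    by (simp add: algebra_simps)
  then have "card K = 1"
    by simp
  then obtain k0 where "K = {k0}"
    by (auto simp: card_1_singleton_iff)
  then show ?thesis
    using incr by (intro that[of k0]) simp
qed

lemma fdiff_incr:
  fixes f1 f2 :: "real ^ 'n::finite \<Rightarrow> int"
  assumes "f1 \<in> height_functions" "f2 \<in> height_functions" "x \<in> lattice_points"
  shows "incr (fdiff f1 f2) x i = 0 \<or> \<bar>incr (fdiff f1 f2) x i\<bar> = int CARD('n)"
  using height_function_incr[OF assms(1,3), of i] height_function_incr[OF assms(2,3), of i]
  by (auto simp: fdiff_def)

text \<open>All increments of the difference are 0 or plus or minus \<open>CARD('n)\<close>, so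
  divisibility propagates along steps from the origin, where both heights are multiples.\<close>

lemma fdiff_multiple:
  fixes f1 f2 :: "real ^ 'n::finite \<Rightarrow> int"
  assumes f: "f1 \<in> height_functions" "f2 \<in> height_functions" and x: "x \<in> lattice_points"
  shows "fdiff f1 f2 x \<in> multiples CARD('n)"
proof -
  let ?g = "fdiff f1 f2"
  have "(int CARD('n) dvd ?g (y + gvec i)) = (int CARD('n) dvd ?g y)" if y: "y \<in> lattice_points" for y i
  proof -
    have "int CARD('n) dvd incr ?g y i"
      using fdiff_incr[OF f y, of i] by (metis dvd_0_right dvd_abs_iff dvd_refl)
    then have "int CARD('n) dvd ?g y + incr ?g y i \<longleftrightarrow> int CARD('n) dvd ?g y"
      by (rule dvd_add_left_iff)
    then show ?thesis
      by simp
  qed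
  then have "(int CARD('n) dvd ?g x) = (int CARD('n) dvd ?g 0)"
    using lattice_step_constant[of "\<lambda>y. int CARD('n) dvd ?g y"] x by blast
  moreover have "int CARD('n) dvd ?g 0"
    using f by (auto simp: height_functions_def multiples_def fdiff_def)
  ultimately show ?thesis
    by (simp add: multiples_def)
qed

section \<open>Level sets, boundaries and the homomorphism given by a difference\<close>

section \<open>Level sets and boundaries\<close>

abbreviation (input) level_set_of :: "(real ^ 'n::finite \<Rightarrow> int) \<Rightarrow> real ^ 'n \<Rightarrow> (real ^ 'n) set" where
  "level_set_of g x \<equiv> level_set_containing g {x}"

lemma Union_level_sets: "\<Union> (level_sets g) = lattice_points"
  unfolding level_sets_def by (rule Union_graph_components)

lemma level_set_unique: "A \<in> level_sets g \<Longrightarrow> B \<in> level_sets g \<Longrightarrow> x \<in> A \<Longrightarrow> x \<in> B \<Longrightarrow> A = B"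
  unfolding level_sets_def by (rule graph_component_unique)

lemma level_set_containing_eqI:
  assumes "A \<in> level_sets g" "S \<subseteq> A" "S \<noteq> {}"
  shows "level_set_containing g S = A"
  unfolding level_set_containing_def
proof (rule the_equality)
  fix B
  assume B: "B \<in> level_sets g \<and> S \<subseteq> B"
  obtain x where "x \<in> S"
    using assms by blast
  then show "B = A"
    using B assms level_set_unique by (meson subsetD)
qed (use assms in auto)

lemma level_set_of_eqI: "A \<in> level_sets g \<Longrightarrow> x \<in> A \<Longrightarrow> level_set_of g x = A"
  by (rule level_set_containing_eqI) auto

lemma level_set_of:
  assumes "x \<in> lattice_points"
  shows "level_set_of g x \<in> level_sets g" "x \<in> level_set_of g x"
proof -
  obtain A where "A \<in> level_sets g" "x \<in> A"
    using assms Union_level_sets[of g] by blast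
  then show "level_set_of g x \<in> level_sets g" "x \<in> level_set_of g x"
    using level_set_of_eqI by metis+
qed

lemma level_set_constant:
  assumes "A \<in> level_sets g" "x \<in> A" "y \<in> A"
  shows "g x = g y"
proof (rule graph_component_invariant[OF assms[unfolded level_sets_def]])
  fix u v
  assume "{u, v} \<in> lattice_edges - jump_edges g"
  then show "g u = g v"
    by (auto simp: jump_edges_def constant_on_def)
qed

lemma level_set_step:
  assumes x: "x \<in> lattice_points" and "incr g x i = 0"
  shows "level_set_of g (x + gvec i) = level_set_of g x"
proof -
  have "{x, x + gvec i} \<in> lattice_edges - jump_edges g"
    using assms lattice_edgeI[OF x] jump_edge_iff[OF x, of i g] by simp
  then have "x + gvec i \<in> level_set_of g x"
    by (rule graph_component_edge[OF level_set_of(1)[OF x, unfolded level_sets_def]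
          level_set_of(2)[OF x] gvec_step_in_lattice[OF x]])
  then show ?thesis
    by (rule level_set_of_eqI[OF level_set_of(1)[OF x]])
qed

lemma level_function_apply:
  assumes "A \<in> level_sets g" "x \<in> A"
  shows "level_function g A = g x"
proof -
  have "g ` A = {g x}"
    using level_set_constant[OF assms(1)] assms(2) by blast
  then show ?thesis
    using assms by (simp add: level_function_def)
qed

lemma level_set_nonempty: "A \<in> level_sets g \<Longrightarrow> A \<noteq> {}"
  unfolding level_sets_def by (rule graph_component_nonempty)

lemma level_set_subset: "A \<in> level_sets g \<Longrightarrow> A \<subseteq> lattice_points"
  using Union_level_sets by blast

lemma Union_boundaries: "\<Union> (boundaries g) = jump_edges g"
  unfolding boundaries_def by (rule Union_graph_components)

lemma boundary_nonempty: "E \<in> boundaries g \<Longrightarrow> E \<noteq> {}"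
  unfolding boundaries_def by (rule graph_component_nonempty)

lemma boundary_unique: "E \<in> boundaries g \<Longrightarrow> E' \<in> boundaries g \<Longrightarrow> e \<in> E \<Longrightarrow> e \<in> E' \<Longrightarrow> E = E'"
  unfolding boundaries_def by (rule graph_component_unique)

text \<open>Distinct boundaries are disjoint, so a union of boundaries contains an edge only by
  containing its whole boundary. This turns choices made edge by edge into choices made boundary by
  boundary.\<close>

lemma in_Union_boundaries_iff:
  assumes "\<C> \<subseteq> boundaries g" "E \<in> boundaries g" "e \<in> E"
  shows "e \<in> \<Union>\<C> \<longleftrightarrow> E \<in> \<C>"
proof
  assume "e \<in> \<Union>\<C>"
  then obtain E' where E': "E' \<in> \<C>" "e \<in> E'"
    by blast
  then have "E' = E"
    using boundary_unique[of E' g E e] assms by blast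
  then show "E \<in> \<C>"
    using E' by simp
qed (use assms in blast)

text \<open>Two distinct jumps on one loop are adjacent in the boundary graph. Adjacency excludes
  equal edges, hence the case split.\<close>

lemma boundary_loop_closed:
  assumes E: "E \<in> boundaries g" "e \<in> E" and e': "e' \<in> jump_edges g"
    and s: "simplicial_loop s" "e \<in> loop_edges s" "e' \<in> loop_edges s"
  shows "e' \<in> E"
proof (cases "e = e'")
  case False
  have "e \<in> jump_edges g"
    using E Union_boundaries by blast
  then have "{e, e'} \<in> boundary_graph_edges g"
    unfolding boundary_graph_edges_def using False e' s by blast
  then show ?thesis
    by (rule graph_component_edge[OF E[unfolded boundaries_def] e'])
qed (use E in simp)

lemma xminus_pair:
  assumes "g x < g y"
  shows "xminus g {x, y} = x" "xminus g {y, x} = x"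
  unfolding xminus_def arg_min_on_def arg_min_def is_arg_min_def
  by (rule some_equality; use assms in auto)+

lemma xplus_pair:
  assumes "g x < g y"
  shows "xplus g {x, y} = y" "xplus g {y, x} = y"
  unfolding xplus_def arg_max_on_def arg_max_def is_arg_max_def
  by (rule some_equality; use assms in auto)+

text \<open>An ordered pair, lower side first: equal sides mean the same two level sets and also the
  same direction of increase.\<close>

definition edge_sides :: "(real ^ 'n::finite \<Rightarrow> int) \<Rightarrow> (real ^ 'n) set \<Rightarrow> (real ^ 'n) set \<times> (real ^ 'n) set" where
  "edge_sides g e = (level_set_of g (xminus g e), level_set_of g (xplus g e))"

lemma level_set_of_arc:
  fixes s :: "nat \<Rightarrow> real ^ 'n::finite"
  assumes s: "loop_along s \<xi>" and ab: "a \<le> b" "b \<le> CARD('n)"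
    and flat: "\<And>m. a < m \<Longrightarrow> m \<le> b \<Longrightarrow> incr g (s (m - 1)) (\<xi> m) = 0"
  shows "level_set_of g (s b) = level_set_of g (s a)"
  using ab flat
proof (induction b rule: dec_induct)
  case (step m)
  have "s m \<in> lattice_points"
    using loop_along_in_lattice[OF s] step.prems by simp
  moreover have "incr g (s m) (\<xi> (Suc m)) = 0"
    using step.prems(2)[of "Suc m"] step.hyps by simp
  ultimately have "level_set_of g (s m + gvec (\<xi> (Suc m))) = level_set_of g (s m)"
    by (rule level_set_step)
  moreover have "s (Suc m) = s m + gvec (\<xi> (Suc m))"
    using loop_along_step[OF s, of "Suc m"] step.prems by simp
  ultimately show ?case
    using step by simp
qed simp

text \<open>Each of \<open>f1\<close> and \<open>f2\<close> drops once along the loop, so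
  \<open>g\<close> can jump only at these two positions, which must be \<open>k\<close> and
  \<open>l\<close>. The inner arc from \<open>s k\<close> to \<open>s (l - 1)\<close> and the outer
  arc from \<open>s l\<close> through the closing point to \<open>s (k - 1)\<close> are free of
  jumps, so each stays in one level set.\<close>

lemma loop_two_jumps:
  fixes f1 f2 :: "real ^ 'n::finite \<Rightarrow> int"
  defines "g \<equiv> fdiff f1 f2"
  assumes f: "f1 \<in> height_functions" "f2 \<in> height_functions" and s: "loop_along s \<xi>"
    and kl: "1 \<le> k" "k < l" "l \<le> CARD('n)"
    and jump: "incr g (s (k - 1)) (\<xi> k) \<noteq> 0" "incr g (s (l - 1)) (\<xi> l) \<noteq> 0"
  shows "edge_sides g {s (k - 1), s k} = edge_sides g {s (l - 1), s l}"
proof -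
  obtain k1 where k1: "\<forall>k\<in>{1..CARD('n)}.
      incr f1 (s (k - 1)) (\<xi> k) = (if k = k1 then 1 - int CARD('n) else 1)"
    by (rule height_function_loop[OF f(1) s])
  obtain k2 where k2: "\<forall>k\<in>{1..CARD('n)}.
      incr f2 (s (k - 1)) (\<xi> k) = (if k = k2 then 1 - int CARD('n) else 1)"
    by (rule height_function_loop[OF f(2) s])
  have incr_g: "incr g (s (m - 1)) (\<xi> m) =
      (if m = k1 then 1 - int CARD('n) else 1) - (if m = k2 then 1 - int CARD('n) else 1)"
    if "m \<in> {1..CARD('n)}" for m
    using bspec[OF k1 that] bspec[OF k2 that] by (simp add: g_def fdiff_def)
  have flat: "incr g (s (m - 1)) (\<xi> m) = 0" if "m \<in> {1..CARD('n)}" "m \<noteq> k" "m \<noteq> l" for m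
  proof -
    have in_range: "k \<in> {1..CARD('n)}" "l \<in> {1..CARD('n)}"
      using kl by auto
    have "k = k1 \<or> k = k2"
      using jump(1) unfolding incr_g[OF in_range(1)] by presburger
    moreover have "l = k1 \<or> l = k2"
      using jump(2) unfolding incr_g[OF in_range(2)] by presburger
    ultimately have "m \<noteq> k1 \<and> m \<noteq> k2"
      using that(2,3) kl(2) by linarith
    then show ?thesis
      unfolding incr_g[OF that(1)] by simp
  qed
  have "level_set_of g (s (k - 1)) = level_set_of g (s 0)"
    using kl flat by (intro level_set_of_arc[OF s]) auto
  also have "s 0 = s CARD('n)"
    using loop_along_closed[OF s] by simp
  also have "level_set_of g (s CARD('n)) = level_set_of g (s l)"
    using kl flat by (intro level_set_of_arc[OF s]) auto
  finally have outer: "level_set_of g (s (k - 1)) = level_set_of g (s l)" .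
  have inner: "level_set_of g (s (l - 1)) = level_set_of g (s k)"
    using kl flat by (intro level_set_of_arc[OF s]) auto
  have g_eq: "g x = g y" if "level_set_of g x = level_set_of g y" "x \<in> lattice_points" "y \<in> lattice_points" for x y
    using level_set_constant[OF level_set_of(1)[OF that(2)] level_set_of(2)[OF that(2)]]
      level_set_of(2)[OF that(3)] that(1) by simp
  have in_lattice: "s (k - 1) \<in> lattice_points" "s k \<in> lattice_points"
    "s (l - 1) \<in> lattice_points" "s l \<in> lattice_points"
    using kl by (auto intro!: loop_along_in_lattice[OF s])
  have g_outer: "g (s (k - 1)) = g (s l)" and g_inner: "g (s (l - 1)) = g (s k)"
    using g_eq outer inner in_lattice by blast+
  have "s k = s (k - 1) + gvec (\<xi> k)"
    using loop_along_step[OF s] kl by simp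
  then have "g (s k) \<noteq> g (s (k - 1))"
    using jump(1) by simp
  \<comment> \<open>The loop crosses the two jumps in opposite senses. If \<open>g\<close> falls at
    \<open>k\<close> it rises at \<open>l\<close>, so the lower endpoints are \<open>s k\<close> and
    \<open>s (l - 1)\<close>; otherwise they are \<open>s (k - 1)\<close> and
    \<open>s l\<close>.\<close>
  then consider "g (s k) < g (s (k - 1))" | "g (s (k - 1)) < g (s k)"
    by linarith
  then show ?thesis
  proof cases
    case 1
    then show ?thesis
      using outer inner g_outer g_inner
      by (simp add: edge_sides_def xminus_pair xplus_pair)
  next
    case 2
    then show ?thesis
      using outer inner g_outer g_inner
      by (simp add: edge_sides_def xminus_pair xplus_pair)
  qed
qed

text \<open>The content behind the well-definedness of \<open>LSD\<close>. Adjacent jumps occupy two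
  different positions of a common loop, so \<open>loop_two_jumps\<close> applies, and
  \<open>graph_component_invariant\<close> carries the sides through the boundary.\<close>

lemma boundary_edge_sides:
  fixes f1 f2 :: "real ^ 'n::finite \<Rightarrow> int"
  defines "g \<equiv> fdiff f1 f2"
  assumes f: "f1 \<in> height_functions" "f2 \<in> height_functions"
    and E: "E \<in> boundaries g" "e \<in> E" "e' \<in> E"
  shows "edge_sides g e = edge_sides g e'"
proof (rule graph_component_invariant[OF E[unfolded boundaries_def]])
  fix u v
  assume "{u, v} \<in> boundary_graph_edges g"
  then obtain e1 e2 s where eq: "{u, v} = {e1, e2}"
    and e: "e1 \<in> jump_edges g" "e2 \<in> jump_edges g" "e1 \<noteq> e2"
    and s: "simplicial_loop s" "e1 \<in> loop_edges s" "e2 \<in> loop_edges s"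
    unfolding boundary_graph_edges_def mem_Collect_eq by (elim exE conjE) (rule that)
  from eq have "u = e1 \<and> v = e2 \<or> u = e2 \<and> v = e1"
    by (simp only: doubleton_eq_iff)
  then have uv: "u \<noteq> v" and u: "u \<in> jump_edges g" "u \<in> loop_edges s"
    and v: "v \<in> jump_edges g" "v \<in> loop_edges s"
    using e s by metis+
  obtain \<xi> where \<xi>: "loop_along s \<xi>"
    using s by (auto simp: simplicial_loop_iff)
  obtain k where k: "k \<in> {1..CARD('n)}" "u = {s (k - 1), s k}"
    using u(2) by (auto simp: loop_edges_def)
  obtain l where l: "l \<in> {1..CARD('n)}" "v = {s (l - 1), s l}"
    using v(2) by (auto simp: loop_edges_def)
  have jump: "incr g (s (m - 1)) (\<xi> m) \<noteq> 0"
    if "m \<in> {1..CARD('n)}" "{s (m - 1), s m} \<in> jump_edges g" for m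
  proof -
    have "m - 1 \<le> CARD('n)"
      using that by auto
    then have "s (m - 1) \<in> lattice_points"
      by (rule loop_along_in_lattice[OF \<xi>])
    then show ?thesis
      using that(2) jump_edge_iff loop_along_step[OF \<xi> that(1)] by metis
  qed
  have "k \<noteq> l"
    using uv k l by blast
  then consider "k < l" | "l < k"
    by linarith
  then show "edge_sides g u = edge_sides g v"
  proof cases
    case 1
    then show ?thesis
      using loop_two_jumps[OF f \<xi> _ 1] jump k l u(1) v(1) unfolding g_def by simp
  next
    case 2
    then show ?thesis
      using loop_two_jumps[OF f \<xi> _ 2] jump k l u(1) v(1) unfolding g_def by simp
  qed
qed

lemma jump_edge_endpoints:
  assumes "e \<in> jump_edges g"
  shows "xminus g e \<in> lattice_points" "xplus g e \<in> lattice_points"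
proof -
  obtain x i where x: "x \<in> lattice_points" "e = {x, x + gvec i}" "incr g x i \<noteq> 0"
    using assms by (rule jump_edgesE)
  then have *: "x + gvec i \<in> lattice_points"
    using gvec_step_in_lattice by blast
  consider "g x < g (x + gvec i)" | "g (x + gvec i) < g x"
    using x(3) by linarith
  then show "xminus g e \<in> lattice_points" "xplus g e \<in> lattice_points"
    using x * by (cases; simp add: xminus_pair xplus_pair)+
qed

text \<open>As all edges of \<open>E\<close> have the same sides, one representative
  \<open>e\<close> computes both endpoints, in place of level sets containing the whole images of
  \<open>E\<close>.\<close>

lemma ends_LSD:
  fixes f1 f2 :: "real ^ 'n::finite \<Rightarrow> int"
  defines "g \<equiv> fdiff f1 f2"
  assumes f: "f1 \<in> height_functions" "f2 \<in> height_functions"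
    and E: "E \<in> boundaries g" "e \<in> E"
  shows "ends (LSD g) E = {level_set_of g (xminus g e), level_set_of g (xplus g e)}"
proof -
  have jump: "e' \<in> jump_edges g" if "e' \<in> E" for e'
    using that E Union_boundaries by blast
  have sides: "edge_sides g e' = edge_sides g e" if "e' \<in> E" for e'
    using boundary_edge_sides[OF f] E that unfolding g_def by blast
  have "xminus g e' \<in> level_set_of g (xminus g e)" if "e' \<in> E" for e'
    using level_set_of(2)[OF jump_edge_endpoints(1)[OF jump[OF that]], of g] sides[OF that]
    by (simp add: edge_sides_def)
  then have 1: "level_set_containing g (xminus g ` E) = level_set_of g (xminus g e)"
    using E level_set_of(1)[OF jump_edge_endpoints(1)[OF jump[OF E(2)]]]
    by (intro level_set_containing_eqI) auto
  have "xplus g e' \<in> level_set_of g (xplus g e)" if "e' \<in> E" for e'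
    using level_set_of(2)[OF jump_edge_endpoints(2)[OF jump[OF that]], of g] sides[OF that]
    by (simp add: edge_sides_def)
  then have 2: "level_set_containing g (xplus g ` E) = level_set_of g (xplus g e)"
    using E level_set_of(1)[OF jump_edge_endpoints(2)[OF jump[OF E(2)]]]
    by (intro level_set_containing_eqI) auto
  show ?thesis
    using E(1) 1 2 by (simp add: LSD_def)
qed

lemma verts_LSD: "verts (LSD g) = level_sets g" and edges_LSD: "edges (LSD g) = boundaries g"
  by (simp_all add: LSD_def)

lemma pair_in_multiples_edges:
  "{a, b} \<in> multiples_edges m \<longleftrightarrow> a \<in> multiples m \<and> b \<in> multiples m \<and> \<bar>a - b\<bar> = int m"
proof
  assume "{a, b} \<in> multiples_edges m"
  then obtain c d where cd: "{a, b} = {c, d}" "c \<in> multiples m" "d \<in> multiples m" "\<bar>c - d\<bar> = int m"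
    unfolding multiples_edges_def mem_Collect_eq by (elim exE conjE) (rule that)
  from cd(1) consider "a = c" "b = d" | "a = d" "b = c"
    unfolding doubleton_eq_iff by blast
  then show "a \<in> multiples m \<and> b \<in> multiples m \<and> \<bar>a - b\<bar> = int m"
    using cd(2-) by cases (simp_all add: abs_minus_commute)
qed (auto simp: multiples_edges_def)

lemma xplus_xminus_difference:
  assumes "e \<in> jump_edges g"
  obtains x i where "x \<in> lattice_points" "e = {x, x + gvec i}"
    "g (xplus g e) - g (xminus g e) = \<bar>incr g x i\<bar>"
proof -
  obtain x i where x: "x \<in> lattice_points" "e = {x, x + gvec i}" "incr g x i \<noteq> 0"
    using assms by (rule jump_edgesE)
  consider "g x < g (x + gvec i)" | "g (x + gvec i) < g x"
    using x(3) by linarith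
  then have "g (xplus g e) - g (xminus g e) = \<bar>incr g x i\<bar>"
    using x by cases (simp_all add: xminus_pair xplus_pair)
  then show ?thesis
    using that x by blast
qed

text \<open>A nonzero increment of \<open>g\<close> has absolute value exactly
  \<open>CARD('n)\<close>, so the two sides of a boundary receive adjacent multiples. The lemma is
  later applied to swapped pairs, not only to the original one.\<close>

lemma level_function_hom:
  fixes f1 f2 :: "real ^ 'n::finite \<Rightarrow> int"
  defines "g \<equiv> fdiff f1 f2"
  assumes f: "f1 \<in> height_functions" "f2 \<in> height_functions"
  shows "level_function g \<in> graph_homs (LSD g) (multiples CARD('n)) (multiples_edges CARD('n))"
proof -
  have mult: "g x \<in> multiples CARD('n)" if "x \<in> lattice_points" for x
    using fdiff_multiple[OF f that] by (simp add: g_def)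
  have "level_function g A \<in> multiples CARD('n)" if A: "A \<in> level_sets g" for A
  proof -
    obtain x where "x \<in> A"
      using level_set_nonempty[OF A] by blast
    then show ?thesis
      using level_function_apply[OF A] level_set_subset[OF A] mult by auto
  qed
  then have "level_function g \<in> level_sets g \<rightarrow>\<^sub>E multiples CARD('n)"
    by (auto simp: level_function_def)
  moreover have "level_function g ` ends (LSD g) E \<in> multiples_edges CARD('n)"
    if E: "E \<in> boundaries g" for E
  proof -
    obtain e where e: "e \<in> E"
      using boundary_nonempty[OF E] by blast
    then have jump: "e \<in> jump_edges g"
      using E Union_boundaries by blast
    obtain x i where x: "x \<in> lattice_points" "e = {x, x + gvec i}"
      "g (xplus g e) - g (xminus g e) = \<bar>incr g x i\<bar>"
      using jump by (rule xplus_xminus_difference)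
    have "incr g x i \<noteq> 0"
      using jump jump_edge_iff x by blast
    then have "\<bar>incr g x i\<bar> = int CARD('n)"
      using fdiff_incr[OF f x(1)] unfolding g_def by blast
    then have diff: "\<bar>g (xminus g e) - g (xplus g e)\<bar> = int CARD('n)"
      using x(3) by linarith
    note pts = jump_edge_endpoints[OF jump]
    have "level_function g ` ends (LSD g) E = {g (xminus g e), g (xplus g e)}"
      using ends_LSD[OF f] E e level_function_apply[OF level_set_of[OF pts(1)]]
        level_function_apply[OF level_set_of[OF pts(2)]]
      unfolding g_def by simp
    then show ?thesis
      using diff mult pts by (simp add: pair_in_multiples_edges)
  qed
  ultimately show ?thesis
    by (simp add: graph_homs_def verts_LSD edges_LSD)
qed

section \<open>Swaps as sign reversals, and the classes they generate\<close>

section \<open>Cluster boundary swaps\<close>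

lemma inv_into_Phi:
  assumes "3 \<le> CARD('n::finite)" "(f :: real ^ 'n \<Rightarrow> int) \<in> height_functions"
  shows "inv_into height_functions Phi (f 0, tiling_of f) = f"
  using inv_into_f_f[OF inj_on_Phi[OF assms(1)] assms(2)] by (simp add: Phi_def)

text \<open>Only two increments are possible, and \<open>f\<close> and \<open>q\<close> disagree on
  \<open>M\<close>; borrowing the increment of \<open>q\<close> there therefore toggles membership
  in the tiling exactly on \<open>M\<close>. It is applied to \<open>f1\<close> with
  \<open>q = f2\<close> and to \<open>f2\<close> with \<open>q = f1\<close>.\<close>

lemma swap_height_function:
  fixes f q u :: "real ^ 'n::finite \<Rightarrow> int"
  assumes card: "3 \<le> CARD('n)" and f: "f \<in> height_functions" and q: "q \<in> height_functions"
    and M: "M \<subseteq> lattice_edges"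
    and jump: "\<And>x i. x \<in> lattice_points \<Longrightarrow> {x, x + gvec i} \<in> M \<Longrightarrow> incr f x i \<noteq> incr q x i"
    and u0: "u 0 = f 0"
    and u: "\<And>x i. x \<in> lattice_points \<Longrightarrow>
      incr u x i = (if {x, x + gvec i} \<in> M then incr q x i else incr f x i)"
  shows "restrict u lattice_points \<in> height_functions"
    and "tiling_of (restrict u lattice_points) = sym_diff (tiling_of f) M"
proof -
  let ?u = "restrict u lattice_points"
  have incr_u: "incr ?u x i = (if {x, x + gvec i} \<in> M then incr q x i else incr f x i)"
    if "x \<in> lattice_points" for x i
    using u[OF that] that gvec_step_in_lattice[OF that] by simp
  show "?u \<in> height_functions"
  proof (rule height_functionI)
    show "int CARD('n) dvd ?u 0"
      using f u0 by (simp add: zero_in_lattice height_functions_def multiples_def)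
    fix x :: "real ^ 'n" and i
    assume x: "x \<in> lattice_points"
    show "incr ?u x i = 1 \<or> incr ?u x i = 1 - int CARD('n)"
      using incr_u[OF x] height_function_incr[OF f x] height_function_incr[OF q x] by metis
  qed simp
  have iff: "{x, x + gvec i} \<in> tiling_of ?u \<longleftrightarrow> {x, x + gvec i} \<in> sym_diff (tiling_of f) M"
    if x: "x \<in> lattice_points" for x i
    using incr_u[OF x, of i] height_function_incr[OF f x, of i] height_function_incr[OF q x, of i]
      jump[OF x, of i] tiling_edge_iff[OF card x, of i f] tiling_edge_iff[OF card x, of i ?u]
    by (cases "{x, x + gvec i} \<in> M") auto
  show "tiling_of ?u = sym_diff (tiling_of f) M"
  proof (rule set_eqI)
    fix e
    show "e \<in> tiling_of ?u \<longleftrightarrow> e \<in> sym_diff (tiling_of f) M"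
    proof (cases "e \<in> lattice_edges")
      case True
      then obtain x i where x: "x \<in> lattice_points" "e = {x, x + gvec i}"
        unfolding lattice_edges_def by blast
      show ?thesis
        using iff[OF x(1), of i] unfolding x(2) .
    next
      case False
      then show ?thesis
        using M tiling_of_subset by blast
    qed
  qed
qed

text \<open>The effect of a swap on the difference: where the two height functions exchange
  increments, \<open>g\<close> changes the sign of its own.\<close>

definition sign_reversal ::
    "(real ^ 'n::finite) set set \<Rightarrow> (real ^ 'n \<Rightarrow> int) \<Rightarrow> (real ^ 'n \<Rightarrow> int) \<Rightarrow> bool" where
  "sign_reversal M g g' \<longleftrightarrow> (\<forall>x\<in>lattice_points. \<forall>i.
     incr g' x i = (if {x, x + gvec i} \<in> M then - incr g x i else incr g x i))"

lemma sign_reversalD: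
  "sign_reversal M g g' \<Longrightarrow> x \<in> lattice_points \<Longrightarrow>
    incr g' x i = (if {x, x + gvec i} \<in> M then - incr g x i else incr g x i)"
  by (simp add: sign_reversal_def)

text \<open>The swapped pair is exhibited as \<open>f1 - h\<close> and \<open>f2 + h\<close>, where
  \<open>h\<close> integrates the increments of \<open>g\<close> on \<open>M\<close>. Its tilings
  are then the prescribed symmetric differences, and injectivity of \<open>Phi\<close> identifies it
  with the value of \<open>cluster_swap\<close>.\<close>

lemma cluster_swap_exists:
  fixes f1 f2 :: "real ^ 'n::finite \<Rightarrow> int"
  defines "g \<equiv> fdiff f1 f2"
  assumes card: "3 \<le> CARD('n)" and f: "f1 \<in> height_functions" "f2 \<in> height_functions"
    and C: "\<C> \<subseteq> boundaries g"
  obtains f1' f2' where "cluster_swap (f1, f2) (\<Union>\<C>) = (f1', f2')"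
    "f1' \<in> height_functions" "f2' \<in> height_functions" "f1' 0 = f1 0" "f2' 0 = f2 0"
    "tiling_of f1' = sym_diff (tiling_of f1) (\<Union>\<C>)" "tiling_of f2' = sym_diff (tiling_of f2) (\<Union>\<C>)"
    "sign_reversal (\<Union>\<C>) g (fdiff f1' f2')"
proof -
  define M where "M = \<Union>\<C>"
  have M: "M \<subseteq> jump_edges g"
    using C Union_boundaries unfolding M_def by blast
  have loop: "(\<Sum>k\<in>{1..CARD('n)}. if {s (k - 1), s (k - 1) + gvec (\<xi> k)} \<in> M
      then incr g (s (k - 1)) (\<xi> k) else 0) = 0" (is "?S = 0") if s: "loop_along s \<xi>" for s \<xi>
  proof -
    have edge: "{s (k - 1), s (k - 1) + gvec (\<xi> k)} \<in> loop_edges s" if "k \<in> {1..CARD('n)}" for k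
      unfolding loop_edges_def loop_along_step[OF s that, symmetric] using that by blast
    have in_lattice: "s (k - 1) \<in> lattice_points" if "k \<in> {1..CARD('n)}" for k
      using that by (intro loop_along_in_lattice[OF s]) auto
    show ?thesis
    proof (cases "\<exists>k\<in>{1..CARD('n)}. {s (k - 1), s (k - 1) + gvec (\<xi> k)} \<in> M")
      case True
      then obtain k E where k: "k \<in> {1..CARD('n)}" and E: "E \<in> \<C>" "{s (k - 1), s (k - 1) + gvec (\<xi> k)} \<in> E"
        unfolding M_def by blast
      have in_M: "{s (l - 1), s (l - 1) + gvec (\<xi> l)} \<in> M"
        if l: "l \<in> {1..CARD('n)}" and "incr g (s (l - 1)) (\<xi> l) \<noteq> 0" for l
      proof -
        have "{s (l - 1), s (l - 1) + gvec (\<xi> l)} \<in> jump_edges g"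
          using that jump_edge_iff[OF in_lattice[OF l]] by simp
        then have "{s (l - 1), s (l - 1) + gvec (\<xi> l)} \<in> E"
          by (rule boundary_loop_closed[OF subsetD[OF C E(1)] E(2) _ _ edge[OF k] edge[OF l]])
            (use s in \<open>simp add: simplicial_loop_iff exI\<close>)
        then show ?thesis
          using E(1) unfolding M_def by (rule UnionI[rotated])
      qed
      \<comment> \<open>All jumps of this loop lie in \<open>M\<close>, and a step outside
        \<open>M\<close> has increment 0 anyway, so the truncated sum is the full sum of increments
        of \<open>g\<close>.\<close>
      have "?S = (\<Sum>k\<in>{1..CARD('n)}. incr g (s (k - 1)) (\<xi> k))"
        by (intro sum.cong refl if_bool_eq_conj[THEN iffD2]) (use in_M in metis)
      then show ?thesis
        using sum_incr_loop[OF s, of g] by simp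
    next
      case False
      then show ?thesis
        by (intro sum.neutral) auto
    qed
  qed
  obtain h where h: "\<forall>x\<in>lattice_points. \<forall>i.
      incr h x i = (if {x, x + gvec i} \<in> M then incr g x i else 0)" "h 0 = 0"
    by (rule lattice_potential[of "\<lambda>x i. if {x, x + gvec i} \<in> M then incr g x i else 0", OF loop])
  define u1 where "u1 x = f1 x - h x" for x
  define u2 where "u2 x = f2 x + h x" for x
  have incr_u1: "incr u1 x i = (if {x, x + gvec i} \<in> M then incr f2 x i else incr f1 x i)"
    if "x \<in> lattice_points" for x i
    using h(1)[rule_format, OF that, of i] by (auto simp: u1_def g_def fdiff_def)
  have incr_u2: "incr u2 x i = (if {x, x + gvec i} \<in> M then incr f1 x i else incr f2 x i)"
    if "x \<in> lattice_points" for x i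
    using h(1)[rule_format, OF that, of i] by (auto simp: u2_def g_def fdiff_def)
  have jump: "incr f1 x i \<noteq> incr f2 x i" if "x \<in> lattice_points" "{x, x + gvec i} \<in> M" for x i
  proof -
    have "incr g x i \<noteq> 0"
      using M that jump_edge_iff by blast
    then show ?thesis
      by (simp add: g_def fdiff_def)
  qed
  have edges: "M \<subseteq> lattice_edges"
    using M by (auto simp: jump_edges_def)
  let ?f1 = "restrict u1 lattice_points" and ?f2 = "restrict u2 lattice_points"
  have 0: "u1 0 = f1 0" "u2 0 = f2 0" "?f1 0 = f1 0" "?f2 0 = f2 0"
    using h(2) by (auto simp: u1_def u2_def zero_in_lattice)
  note s1 = swap_height_function[OF card f edges jump 0(1) incr_u1]
  note s2 = swap_height_function[OF card f(2,1) edges jump[symmetric] 0(2) incr_u2]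
  show ?thesis
  proof (rule that)
    show "cluster_swap (f1, f2) (\<Union>\<C>) = (?f1, ?f2)"
      using inv_into_Phi[OF card s1(1)] inv_into_Phi[OF card s2(1)]
      by (simp only: cluster_swap_def M_def[symmetric] s1(2) s2(2) 0 prod.case)
    have "incr (fdiff ?f1 ?f2) x i = (if {x, x + gvec i} \<in> M then - incr g x i else incr g x i)"
      if x: "x \<in> lattice_points" for x i
      using incr_u1[OF x, of i] incr_u2[OF x, of i] x gvec_step_in_lattice[OF x]
      by (auto simp: fdiff_def g_def)
    then show "sign_reversal (\<Union>\<C>) g (fdiff ?f1 ?f2)"
      unfolding sign_reversal_def M_def by blast
  qed (use s1 s2 0 in \<open>simp_all add: M_def\<close>)
qed

lemma jump_edges_cong:
  assumes "jump_edges g' = jump_edges g"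
  shows "boundaries g' = boundaries g" "level_sets g' = level_sets g"
    "level_set_containing g' = level_set_containing g"
  using assms by (simp_all add: boundaries_def boundary_graph_edges_def level_sets_def
      level_set_containing_def fun_eq_iff)

text \<open>Negation does not affect whether an increment vanishes, so the jumps are unchanged. On
  the boundaries in \<open>\<C>\<close> the lower and upper endpoints trade places, which the
  unordered set \<open>ends\<close> does not see.\<close>

lemma sign_reversal_LSD:
  fixes g g' :: "real ^ 'n::finite \<Rightarrow> int"
  assumes C: "\<C> \<subseteq> boundaries g"
    and rev: "sign_reversal (\<Union>\<C>) g g'"
  shows "jump_edges g' = jump_edges g" "LSD g' = LSD g"
proof -
  note incr = sign_reversalD[OF rev]
  have "e \<in> jump_edges g' \<longleftrightarrow> e \<in> jump_edges g" if e: "e \<in> lattice_edges" for e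
  proof -
    obtain x i where x: "x \<in> lattice_points" "e = {x, x + gvec i}"
      using e by (auto simp: lattice_edges_def)
    show ?thesis
      using incr[OF x(1), of i] unfolding x(2) jump_edge_iff[OF x(1)] by (auto split: if_splits)
  qed
  then show jump: "jump_edges g' = jump_edges g"
    by (auto simp: jump_edges_def)
  have swap: "(if e \<in> \<Union>\<C> then xminus g' e = xplus g e \<and> xplus g' e = xminus g e
      else xminus g' e = xminus g e \<and> xplus g' e = xplus g e)" if e: "e \<in> jump_edges g" for e
  proof -
    obtain x i where x: "x \<in> lattice_points" "e = {x, x + gvec i}" "incr g x i \<noteq> 0"
      using e by (rule jump_edgesE)
    consider "g x < g (x + gvec i)" | "g (x + gvec i) < g x"
      using x(3) by linarith
    then show ?thesis
    proof cases
      case 1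
      then show ?thesis
      proof (cases "e \<in> \<Union>\<C>")
        case True
        then have "g' (x + gvec i) < g' x"
          using 1 incr[OF x(1), of i] x(2) by simp
        then show ?thesis
          using True 1 by (simp add: x(2) xminus_pair xplus_pair)
      next
        case False
        then have "g' x < g' (x + gvec i)"
          using 1 incr[OF x(1), of i] x(2) by simp
        then show ?thesis
          using False 1 by (simp add: x(2) xminus_pair xplus_pair)
      qed
    next
      case 2
      then show ?thesis
      proof (cases "e \<in> \<Union>\<C>")
        case True
        then have "g' x < g' (x + gvec i)"
          using 2 incr[OF x(1), of i] x(2) by simp
        then show ?thesis
          using True 2 by (simp add: x(2) xminus_pair xplus_pair)
      next
        case False
        then have "g' (x + gvec i) < g' x"
          using 2 incr[OF x(1), of i] x(2) by simp
        then show ?thesis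
          using False 2 by (simp add: x(2) xminus_pair xplus_pair)
      qed
    qed
  qed
  note cong = jump_edges_cong[OF jump]
  have "{level_set_containing g (xminus g' ` E), level_set_containing g (xplus g' ` E)} =
      {level_set_containing g (xminus g ` E), level_set_containing g (xplus g ` E)}"
    if E: "E \<in> boundaries g" for E
  proof -
    have E_jump: "e \<in> jump_edges g" if "e \<in> E" for e
      using that E Union_boundaries by blast
    show ?thesis
    proof (cases "E \<in> \<C>")
      case True
      have "xminus g' e = xplus g e \<and> xplus g' e = xminus g e" if "e \<in> E" for e
        using swap[OF E_jump[OF that]] in_Union_boundaries_iff[OF C E that] True by simp
      then have "xminus g' ` E = xplus g ` E" "xplus g' ` E = xminus g ` E"
        by (auto intro!: image_cong)
      then show ?thesis
        by (simp add: insert_commute)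
    next
      case False
      have "xminus g' e = xminus g e \<and> xplus g' e = xplus g e" if "e \<in> E" for e
        using swap[OF E_jump[OF that]] in_Union_boundaries_iff[OF C E that] False by simp
      then have "xminus g' ` E = xminus g ` E" "xplus g' ` E = xplus g ` E"
        by (auto intro!: image_cong)
      then show ?thesis
        by simp
    qed
  qed
  then show "LSD g' = LSD g"
    unfolding LSD_def cong by (simp cong: restrict_cong)
qed

lemma swap_relE:
  fixes f1 f2 :: "real ^ 'n::finite \<Rightarrow> int"
  assumes card: "3 \<le> CARD('n)" and rel: "((f1, f2), p) \<in> swap_rel"
  obtains \<C> f1' f2' where "p = (f1', f2')" "\<C> \<subseteq> boundaries (fdiff f1 f2)"
    "cluster_swap (f1, f2) (\<Union>\<C>) = (f1', f2')"
    "f1' \<in> height_functions" "f2' \<in> height_functions" "f1' 0 = f1 0" "f2' 0 = f2 0"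
    "tiling_of f1' = sym_diff (tiling_of f1) (\<Union>\<C>)" "tiling_of f2' = sym_diff (tiling_of f2) (\<Union>\<C>)"
    "sign_reversal (\<Union>\<C>) (fdiff f1 f2) (fdiff f1' f2')"
    "jump_edges (fdiff f1' f2') = jump_edges (fdiff f1 f2)"
    "LSD (fdiff f1' f2') = LSD (fdiff f1 f2)"
proof -
  obtain \<C> where C: "\<C> \<subseteq> boundaries (fdiff f1 f2)" "p = cluster_swap (f1, f2) (\<Union>\<C>)"
    and f: "f1 \<in> height_functions" "f2 \<in> height_functions"
    using rel by (auto simp: swap_rel_def)
  obtain f1' f2' where swap: "cluster_swap (f1, f2) (\<Union>\<C>) = (f1', f2')"
    and f': "f1' \<in> height_functions" "f2' \<in> height_functions" "f1' 0 = f1 0" "f2' 0 = f2 0"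
    and T: "tiling_of f1' = sym_diff (tiling_of f1) (\<Union>\<C>)" "tiling_of f2' = sym_diff (tiling_of f2) (\<Union>\<C>)"
    and rev: "sign_reversal (\<Union>\<C>) (fdiff f1 f2) (fdiff f1' f2')"
    by (rule cluster_swap_exists[OF card f C(1)])
  show ?thesis
    by (rule that[OF _ C(1) swap f' T rev sign_reversal_LSD[OF C(1) rev]]) (simp add: C(2) swap)
qed

lemma swap_relI:
  assumes "f1 \<in> height_functions" "f2 \<in> height_functions" "\<C> \<subseteq> boundaries (fdiff f1 f2)"
    "cluster_swap (f1, f2) (\<Union>\<C>) = p"
  shows "((f1, f2), p) \<in> swap_rel"
  using assms by (auto simp: swap_rel_def)

text \<open>Swaps act on tilings by symmetric difference and leave the boundaries unchanged. The
  empty family gives reflexivity, repeating the same family undoes a swap, and two successive swaps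
  amount to one along the symmetric difference of their families.\<close>

lemma equiv_swap_rel:
  assumes card: "3 \<le> CARD('n::finite)"
  shows "equiv (height_functions \<times> height_functions)
    (swap_rel :: ((real ^ 'n \<Rightarrow> int) \<times> (real ^ 'n \<Rightarrow> int)) rel)"
proof (rule equivI)
  show "swap_rel \<subseteq> (height_functions \<times> height_functions) \<times>
      ((height_functions \<times> height_functions) :: ((real ^ 'n \<Rightarrow> int) \<times> (real ^ 'n \<Rightarrow> int)) set)"
  proof (rule subsetI)
    fix r :: "((real ^ 'n \<Rightarrow> int) \<times> (real ^ 'n \<Rightarrow> int)) \<times> ((real ^ 'n \<Rightarrow> int) \<times> (real ^ 'n \<Rightarrow> int))"
    assume r: "r \<in> swap_rel"
    obtain f1 f2 p where rp: "r = ((f1, f2), p)"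
      by (metis surj_pair)
    then have "f1 \<in> height_functions" "f2 \<in> height_functions"
      using r by (auto simp: swap_rel_def)
    then show "r \<in> (height_functions \<times> height_functions) \<times> (height_functions \<times> height_functions)"
      using swap_relE[OF card r[unfolded rp]] rp by auto
  qed
  show "refl_on (height_functions \<times> height_functions)
      (swap_rel :: ((real ^ 'n \<Rightarrow> int) \<times> (real ^ 'n \<Rightarrow> int)) rel)"
  proof (rule refl_onI)
    fix p :: "(real ^ 'n \<Rightarrow> int) \<times> (real ^ 'n \<Rightarrow> int)"
    assume p: "p \<in> height_functions \<times> height_functions"
    obtain f1 f2 where f: "p = (f1, f2)" "f1 \<in> height_functions" "f2 \<in> height_functions"
      using p by blast
    have "cluster_swap (f1, f2) (\<Union>{}) = p"
      using inv_into_Phi[OF card f(2)] inv_into_Phi[OF card f(3)]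
      by (simp add: cluster_swap_def f(1))
    then show "(p, p) \<in> swap_rel"
      using f swap_relI[of f1 f2 "{}" p] by simp
  qed
  show "sym (swap_rel :: ((real ^ 'n \<Rightarrow> int) \<times> (real ^ 'n \<Rightarrow> int)) rel)"
  proof (rule symI)
    fix p q :: "(real ^ 'n \<Rightarrow> int) \<times> (real ^ 'n \<Rightarrow> int)"
    assume pq: "(p, q) \<in> swap_rel"
    obtain f1 f2 where p: "p = (f1, f2)"
      by fastforce
    have f: "f1 \<in> height_functions" "f2 \<in> height_functions"
      using pq by (auto simp: swap_rel_def p)
    from pq[unfolded p] obtain \<C> f1' f2' where q: "q = (f1', f2')"
      and C: "\<C> \<subseteq> boundaries (fdiff f1 f2)"
      and f': "f1' \<in> height_functions" "f2' \<in> height_functions" "f1' 0 = f1 0" "f2' 0 = f2 0"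
      and T: "tiling_of f1' = sym_diff (tiling_of f1) (\<Union>\<C>)" "tiling_of f2' = sym_diff (tiling_of f2) (\<Union>\<C>)"
      and jump: "jump_edges (fdiff f1' f2') = jump_edges (fdiff f1 f2)"
      by (rule swap_relE[OF card])
    have "sym_diff (sym_diff A B) B = A" for A B :: "(real ^ 'n) set set"
      by blast
    then have "cluster_swap (f1', f2') (\<Union>\<C>) = (f1, f2)"
      using inv_into_Phi[OF card f(1)] inv_into_Phi[OF card f(2)]
      by (simp add: cluster_swap_def T f'(3,4))
    then show "(q, p) \<in> swap_rel"
      unfolding p q using C f' jump_edges_cong(1)[OF jump] by (intro swap_relI) auto
  qed
  show "trans (swap_rel :: ((real ^ 'n \<Rightarrow> int) \<times> (real ^ 'n \<Rightarrow> int)) rel)"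
  proof (rule transI)
    fix p q r :: "(real ^ 'n \<Rightarrow> int) \<times> (real ^ 'n \<Rightarrow> int)"
    assume pq: "(p, q) \<in> swap_rel" and qr: "(q, r) \<in> swap_rel"
    obtain f1 f2 where p: "p = (f1, f2)"
      by fastforce
    have f: "f1 \<in> height_functions" "f2 \<in> height_functions"
      using pq by (auto simp: swap_rel_def p)
    from pq[unfolded p] obtain \<C> f1' f2' where q: "q = (f1', f2')"
      and C: "\<C> \<subseteq> boundaries (fdiff f1 f2)"
      and f': "f1' 0 = f1 0" "f2' 0 = f2 0"
      and T: "tiling_of f1' = sym_diff (tiling_of f1) (\<Union>\<C>)" "tiling_of f2' = sym_diff (tiling_of f2) (\<Union>\<C>)"
      and jump: "jump_edges (fdiff f1' f2') = jump_edges (fdiff f1 f2)"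
      by (rule swap_relE[OF card])
    from qr obtain \<D> where D: "\<D> \<subseteq> boundaries (fdiff f1 f2)" "r = cluster_swap (f1', f2') (\<Union>\<D>)"
      by (auto simp: swap_rel_def q jump_edges_cong(1)[OF jump])
    \<comment> \<open>This depends on boundaries being pairwise disjoint; for overlapping members
      the two sides may differ.\<close>
    have "\<Union>(sym_diff \<C> \<D>) = sym_diff (\<Union>\<C>) (\<Union>\<D>)"
      using C D(1) boundary_unique by blast
    moreover have "sym_diff (sym_diff A B) B' = sym_diff A (sym_diff B B')"
      for A B B' :: "(real ^ 'n) set set"
      by blast
    ultimately have "cluster_swap (f1, f2) (\<Union>(sym_diff \<C> \<D>)) = r"
      by (simp only: D(2) cluster_swap_def T f' prod.case)
    then show "(p, r) \<in> swap_rel"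
      unfolding p using f C D(1) by (intro swap_relI[of _ _ "sym_diff \<C> \<D>"]) auto
  qed
qed

text \<open>The level function determines the new difference on the lattice. On a jump the old
  increment is nonzero, so its sign tells whether the edge was swapped; thus the union of boundaries
  is recovered, and with it the pair.\<close>

lemma swap_class_inj:
  fixes f1 f2 :: "real ^ 'n::finite \<Rightarrow> int"
  assumes card: "3 \<le> CARD('n)"
  shows "inj_on (\<lambda>(f1', f2'). level_function (fdiff f1' f2')) (swap_rel `` {(f1, f2)})"
proof (rule inj_onI)
  let ?g = "fdiff f1 f2"
  fix p q
  assume "p \<in> swap_rel `` {(f1, f2)}" and "q \<in> swap_rel `` {(f1, f2)}"
    and eq: "(case p of (f1', f2') \<Rightarrow> level_function (fdiff f1' f2')) =
      (case q of (f1', f2') \<Rightarrow> level_function (fdiff f1' f2'))"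
  then have pq: "((f1, f2), p) \<in> swap_rel" "((f1, f2), q) \<in> swap_rel"
    by auto
  from pq(1) obtain \<C> p1 p2 where p: "p = (p1, p2)" and C: "\<C> \<subseteq> boundaries ?g"
    and swap_p: "cluster_swap (f1, f2) (\<Union>\<C>) = (p1, p2)"
    and rev_p: "sign_reversal (\<Union>\<C>) ?g (fdiff p1 p2)"
    and jump_p: "jump_edges (fdiff p1 p2) = jump_edges ?g"
    by (rule swap_relE[OF card])
  from pq(2) obtain \<D> q1 q2 where q: "q = (q1, q2)" and D: "\<D> \<subseteq> boundaries ?g"
    and swap_q: "cluster_swap (f1, f2) (\<Union>\<D>) = (q1, q2)"
    and rev_q: "sign_reversal (\<Union>\<D>) ?g (fdiff q1 q2)"
    and jump_q: "jump_edges (fdiff q1 q2) = jump_edges ?g"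
    by (rule swap_relE[OF card])
  have same: "fdiff p1 p2 x = fdiff q1 q2 x" if x: "x \<in> lattice_points" for x
  proof -
    note A = level_set_of[OF x, of ?g]
    have "fdiff p1 p2 x = level_function (fdiff p1 p2) (level_set_of ?g x)"
      using level_function_apply A jump_edges_cong(2)[OF jump_p] by metis
    also have "\<dots> = level_function (fdiff q1 q2) (level_set_of ?g x)"
      using eq by (simp add: p q)
    also have "\<dots> = fdiff q1 q2 x"
      using level_function_apply A jump_edges_cong(2)[OF jump_q] by metis
    finally show ?thesis .
  qed
  have "e \<in> \<Union>\<C> \<longleftrightarrow> e \<in> \<Union>\<D>" if e: "e \<in> jump_edges ?g" for e
  proof -
    obtain x i where x: "x \<in> lattice_points" "e = {x, x + gvec i}" "incr ?g x i \<noteq> 0"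
      using e by (rule jump_edgesE)
    have "incr (fdiff p1 p2) x i = incr (fdiff q1 q2) x i"
      using same x(1) gvec_step_in_lattice by metis
    then have "(if e \<in> \<Union>\<C> then - incr ?g x i else incr ?g x i) =
        (if e \<in> \<Union>\<D> then - incr ?g x i else incr ?g x i)"
      using sign_reversalD[OF rev_p x(1), of i] sign_reversalD[OF rev_q x(1), of i] unfolding x(2) by simp
    then show ?thesis
      using x(3) by (simp split: if_splits)
  qed
  moreover have "\<Union>\<C> \<subseteq> jump_edges ?g" "\<Union>\<D> \<subseteq> jump_edges ?g"
    using C D Union_boundaries by blast+
  ultimately have "\<Union>\<C> = \<Union>\<D>"
    by blast
  then show "p = q"
    using swap_p swap_q p q by simp
qed

text \<open>Pull \<open>\<phi>\<close> back to a function \<open>q\<close> on the lattice and swap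
  the boundaries across which \<open>q\<close> falls while \<open>g\<close> rises. The resulting
  difference agrees with \<open>q\<close> at the origin and in all increments, hence on the whole
  lattice.\<close>

lemma graph_hom_realised:
  fixes f1 f2 :: "real ^ 'n::finite \<Rightarrow> int"
  defines "g \<equiv> fdiff f1 f2"
  assumes card: "3 \<le> CARD('n)" and f: "f1 \<in> height_functions" "f2 \<in> height_functions"
    and hom: "\<phi> \<in> graph_homs (LSD g) (multiples CARD('n)) (multiples_edges CARD('n))"
    and \<phi>0: "\<phi> (level_set_of g 0) = g 0"
  obtains f1' f2' where "((f1, f2), (f1', f2')) \<in> swap_rel" "level_function (fdiff f1' f2') = \<phi>"
proof -
  define q where "q x = \<phi> (level_set_of g x)" for x
  define \<C> where "\<C> = {E \<in> boundaries g. \<exists>e\<in>E. q (xplus g e) < q (xminus g e)}"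
  have C: "\<C> \<subseteq> boundaries g"
    by (auto simp: \<C>_def)
  obtain f1' f2' where swap: "cluster_swap (f1, f2) (\<Union>\<C>) = (f1', f2')"
    and "f1' \<in> height_functions" "f2' \<in> height_functions"
    and f': "f1' 0 = f1 0" "f2' 0 = f2 0"
    and "tiling_of f1' = sym_diff (tiling_of f1) (\<Union>\<C>)" "tiling_of f2' = sym_diff (tiling_of f2) (\<Union>\<C>)"
    and rev: "sign_reversal (\<Union>\<C>) g (fdiff f1' f2')"
    unfolding g_def by (rule cluster_swap_exists[OF card f C[unfolded g_def]])
  have jump': "jump_edges (fdiff f1' f2') = jump_edges g"
    using sign_reversal_LSD(1)[OF C rev] .
  have q_jump: "\<bar>q (xminus g e) - q (xplus g e)\<bar> = int CARD('n)"
    if "E \<in> boundaries g" "e \<in> E" for E e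
  proof -
    have "\<phi> ` ends (LSD g) E \<in> multiples_edges CARD('n)"
      using hom that by (simp add: graph_homs_def edges_LSD)
    moreover have "\<phi> ` ends (LSD g) E = {q (xminus g e), q (xplus g e)}"
      using ends_LSD[OF f that[unfolded g_def]] by (simp add: g_def q_def)
    ultimately show ?thesis
      by (simp add: pair_in_multiples_edges)
  qed
  have incr_q: "incr (fdiff f1' f2') x i = incr q x i" if x: "x \<in> lattice_points" for x i
  proof (cases "incr g x i = 0")
    case True
    then have "incr q x i = 0"
      using level_set_step[OF x] by (simp add: q_def)
    then show ?thesis
      using sign_reversalD[OF rev x, of i] True by simp
  next
    case False
    let ?e = "{x, x + gvec i}"
    have "?e \<in> jump_edges g"
      using False jump_edge_iff[OF x] by blast
    then obtain E where E: "E \<in> boundaries g" "?e \<in> E"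
      using Union_boundaries by blast
    \<comment> \<open>The definition of \<open>\<C>\<close> asks for some edge of \<open>E\<close>;
      since all edges of \<open>E\<close> have the same sides, the condition may be tested on the
      given edge.\<close>
    have same: "q (xplus g e) = q (xplus g ?e) \<and> q (xminus g e) = q (xminus g ?e)" if "e \<in> E" for e
    proof -
      have "edge_sides g e = edge_sides g ?e"
        using boundary_edge_sides[OF f] E that unfolding g_def by blast
      then show ?thesis
        by (simp add: edge_sides_def q_def)
    qed
    have "E \<in> \<C> \<longleftrightarrow> q (xplus g ?e) < q (xminus g ?e)"
    proof
      assume "E \<in> \<C>"
      then obtain e where "e \<in> E" "q (xplus g e) < q (xminus g e)"
        unfolding \<C>_def by blast
      then show "q (xplus g ?e) < q (xminus g ?e)"
        using same[of e] by simp
    next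
      assume "q (xplus g ?e) < q (xminus g ?e)"
      then show "E \<in> \<C>"
        unfolding \<C>_def using E by (intro CollectI conjI bexI[of _ ?e])
    qed
    then have iff: "?e \<in> \<Union>\<C> \<longleftrightarrow> q (xplus g ?e) < q (xminus g ?e)"
      using in_Union_boundaries_iff[OF C E] by blast
    have abs_g: "\<bar>incr g x i\<bar> = int CARD('n)"
      using fdiff_incr[OF f x, of i] False unfolding g_def by blast
    note abs_q = q_jump[OF E]
    \<comment> \<open>Both increments have absolute value \<open>CARD('n)\<close>, so only the signs
      remain to be compared.\<close>
    consider "g x < g (x + gvec i)" | "g (x + gvec i) < g x"
      using False by linarith
    then show ?thesis
    proof cases
      case 1
      then have "xminus g ?e = x" "xplus g ?e = x + gvec i"
        by (simp_all add: xminus_pair xplus_pair)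
      then show ?thesis
        using 1 iff abs_g abs_q sign_reversalD[OF rev x, of i] by (auto split: if_splits)
    next
      case 2
      then have "xminus g ?e = x + gvec i" "xplus g ?e = x"
        by (simp_all add: xminus_pair xplus_pair)
      then show ?thesis
        using 2 iff abs_g abs_q sign_reversalD[OF rev x, of i] by (auto split: if_splits)
    qed
  qed
  have "fdiff f1' f2' 0 = q 0"
    using \<phi>0 f' by (simp add: q_def g_def fdiff_def)
  then have g'_eq: "fdiff f1' f2' x = q x" if "x \<in> lattice_points" for x
    using lattice_fun_eqI incr_q that by blast
  have "level_function (fdiff f1' f2') A = \<phi> A" if A: "A \<in> level_sets g" for A
  proof -
    obtain x where x: "x \<in> A"
      using level_set_nonempty[OF A] by blast
    have "level_function (fdiff f1' f2') A = fdiff f1' f2' x"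
      using level_function_apply A x jump_edges_cong(2)[OF jump'] by metis
    also have "\<dots> = q x"
      using g'_eq x level_set_subset[OF A] by blast
    also have "\<dots> = \<phi> A"
      using level_set_of_eqI[OF A x] by (simp add: q_def)
    finally show ?thesis .
  qed
  moreover have "\<phi> \<in> extensional (level_sets g)"
    using hom by (simp add: graph_homs_def verts_LSD PiE_def)
  moreover have "level_function (fdiff f1' f2') \<in> extensional (level_sets g)"
    by (simp add: level_function_def jump_edges_cong(2)[OF jump'])
  ultimately have "level_function (fdiff f1' f2') = \<phi>"
    by (intro extensionalityI)
  moreover have "((f1, f2), (f1', f2')) \<in> swap_rel"
    using f C swap unfolding g_def by (intro swap_relI)
  ultimately show ?thesis
    by (rule that[rotated])
qed

text \<open>A swapped pair again consists of height functions, so its level function is a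
  homomorphism on its own \<open>LSD\<close>, which is that of \<open>g\<close>. The condition at
  the origin holds because swaps fix both values at 0.\<close>

lemma swap_class_bij:
  fixes f1 f2 :: "real ^ 'n::finite \<Rightarrow> int"
  defines "g \<equiv> fdiff f1 f2"
  assumes card: "3 \<le> CARD('n)" and f: "f1 \<in> height_functions" "f2 \<in> height_functions"
  shows "bij_betw (\<lambda>(f1', f2'). level_function (fdiff f1' f2')) (swap_rel `` {(f1, f2)})
    {\<phi> \<in> graph_homs (LSD g) (multiples CARD('n)) (multiples_edges CARD('n)).
       \<phi> (level_set_of g 0) = g 0}" (is "bij_betw ?F ?X ?Y")
proof (rule bij_betw_imageI)
  show "inj_on ?F ?X"
    by (rule swap_class_inj[OF card])
  show "?F ` ?X = ?Y"
  proof
    show "?F ` ?X \<subseteq> ?Y"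
    proof (rule image_subsetI)
      fix p
      assume "p \<in> ?X"
      then have "((f1, f2), p) \<in> swap_rel"
        by simp
      then obtain f1' f2' where p: "p = (f1', f2')"
        and f': "f1' \<in> height_functions" "f2' \<in> height_functions" "f1' 0 = f1 0" "f2' 0 = f2 0"
        and jump: "jump_edges (fdiff f1' f2') = jump_edges g"
        and LSD: "LSD (fdiff f1' f2') = LSD g"
        unfolding g_def by (rule swap_relE[OF card])
      have "level_function (fdiff f1' f2') (level_set_of g 0) = fdiff f1' f2' 0"
        using level_function_apply level_set_of[OF zero_in_lattice] jump_edges_cong(3)[OF jump] by metis
      moreover have "fdiff f1' f2' 0 = g 0"
        using f'(3,4) by (simp add: g_def fdiff_def)
      ultimately show "?F p \<in> ?Y"
        using level_function_hom[OF f'(1,2)] by (simp add: p LSD)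
    qed
    show "?Y \<subseteq> ?F ` ?X"
    proof
      fix \<phi>
      assume "\<phi> \<in> ?Y"
      then obtain f1' f2' where "((f1, f2), (f1', f2')) \<in> swap_rel"
        "level_function (fdiff f1' f2') = \<phi>"
        using graph_hom_realised[OF card f] unfolding g_def by blast
      then show "\<phi> \<in> ?F ` ?X"
        by (intro image_eqI[of _ _ "(f1', f2')"]) auto
    qed
  qed
qed

theorem theorem4p9:
  fixes d :: nat
  assumes "2 \<le> d" and "CARD('n::finite) = d + 1"
  shows "equiv (height_functions \<times> height_functions)
           (swap_rel :: ((real ^ 'n \<Rightarrow> int) \<times> (real ^ 'n \<Rightarrow> int)) rel) \<and>
    (\<forall>f1 \<in> height_functions. \<forall>f2 \<in> (height_functions :: (real ^ 'n \<Rightarrow> int) set).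
       (\<forall>(f1', f2') \<in> swap_rel `` {(f1, f2)}. LSD (fdiff f1' f2') = LSD (fdiff f1 f2)) \<and>
       bij_betw (\<lambda>(f1', f2'). level_function (fdiff f1' f2')) (swap_rel `` {(f1, f2)})
         {\<phi> \<in> graph_homs (LSD (fdiff f1 f2)) (multiples (d + 1)) (multiples_edges (d + 1)).
            \<phi> (level_set_containing (fdiff f1 f2) {0}) = fdiff f1 f2 0})"
proof (intro conjI ballI)
  have card: "3 \<le> CARD('n)"
    using assms by simp
  show "equiv (height_functions \<times> height_functions)
      (swap_rel :: ((real ^ 'n \<Rightarrow> int) \<times> (real ^ 'n \<Rightarrow> int)) rel)"
    by (rule equiv_swap_rel[OF card])
  fix f1 f2 :: "real ^ 'n \<Rightarrow> int"
  assume f: "f1 \<in> height_functions" "f2 \<in> height_functions"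
  show "bij_betw (\<lambda>(f1', f2'). level_function (fdiff f1' f2')) (swap_rel `` {(f1, f2)})
      {\<phi> \<in> graph_homs (LSD (fdiff f1 f2)) (multiples (d + 1)) (multiples_edges (d + 1)).
         \<phi> (level_set_containing (fdiff f1 f2) {0}) = fdiff f1 f2 0}"
    using swap_class_bij[OF card f] assms(2) by simp
  fix p
  assume "p \<in> swap_rel `` {(f1, f2)}"
  then have "((f1, f2), p) \<in> swap_rel"
    by simp
  then show "case p of (f1', f2') \<Rightarrow> LSD (fdiff f1' f2') = LSD (fdiff f1 f2)"
    by (rule swap_relE[OF card]) simp
qed

end
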